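(* Let $\Gamma$ be a countable group, let $\varphi_o:\Gamma\to\mathbb{R}$ be a quasimorphism with $\varphi_o(e)=0$, and let $p$ be a symmetric probability measure on $\Gamma$ whose support generates $\Gamma$ and such that $\varphi_o$ is $p$-integrable. Then $\varphi_o$ is equivalent to a quasimorphism $\varphi_1:\Gamma\to\mathbb{Z}$ such that $\Delta_{\varphi_1}$ admits uncountably many $p$-stationary and $\Gamma$-ergodic probability measures. If $\Gamma$ surjects onto $\mathbb{Z}$, then $\varphi_1$ can be chosen to be antisymmetric.
   Context: $\varphi:\Gamma\to\mathbb{R}$ is a quasimorphism if $\sup_{g,h}|\varphi(gh)-\varphi(g)-\varphi(h)|<\infty$; all quasimorphisms are assumed normalized, i.e. vanishing at $e$. Two quasimorphisms are equivalent if their difference is bounded. A quasimorphism is antisymmetric if $\varphi(\gamma^{-1})=-\varphi(\gamma)$ for all $\gamma$. $\varphi_o$ is $p$-integrable if $\sum_\gamma p(\gamma)|\varphi_o(\gamma)|<\infty$. $\mathscr{F}_o(\Gamma):=\{\varphi\in\mathbb{R}^\Gamma\mid\varphi(e)=0\}$ carries the product topology and the $\Gamma$-action $(\gamma.\varphi)(\gamma')=\varphi(\gamma'\gamma)-\varphi(\gamma)$; $\Delta_\varphi$ denotes the closure of the $\Gamma$-orbit of $\varphi$ in $\mathscr{F}_o(\Gamma)$. A Borel probability measure $\nu$ is $p$-stationary if $p*\nu=\nu$.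
   Formalization: The group Γ is assumed to be countably infinite; for a finite group the orbit closure is finite and carries only finitely many p-stationary ergodic probability measures, so the claim fails there. *)

theory Defs
  imports "HOL-Probability.Probability"
begin

text \<open>
  The group \<open>\<Gamma>\<close> is a type of class \<open>group_add\<close>.  That class does not assume commutativity,
  so \<open>g + h\<close>, \<open>0\<close> and \<open>- g\<close> stand for the product \<open>gh\<close>, the neutral element \<open>e\<close> and the
  inverse of an arbitrary group.
\<close>

definition is_subgroup :: "'a::group_add set \<Rightarrow> bool" where
  "is_subgroup H \<longleftrightarrow> 0 \<in> H \<and> (\<forall>g\<in>H. \<forall>h\<in>H. g + h \<in> H) \<and> (\<forall>g\<in>H. - g \<in> H)"

definition generates :: "'a::group_add set \<Rightarrow> bool" where
  "generates S \<longleftrightarrow> is_subgroup hull S = UNIV"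

definition surjects_onto_int :: "'a::group_add itself \<Rightarrow> bool" where
  "surjects_onto_int _ \<longleftrightarrow> (\<exists>f :: 'a \<Rightarrow> int. surj f \<and> (\<forall>g h. f (g + h) = f g + f h))"

text \<open>All quasimorphisms are normalized to vanish at the neutral element.\<close>

definition quasimorphism :: "('a::group_add \<Rightarrow> real) \<Rightarrow> bool" where
  "quasimorphism \<phi> \<longleftrightarrow>
     \<phi> 0 = 0 \<and> bdd_above (range (\<lambda>(g, h). \<bar>\<phi> (g + h) - \<phi> g - \<phi> h\<bar>))"

definition qm_equivalent :: "('a \<Rightarrow> real) \<Rightarrow> ('a \<Rightarrow> real) \<Rightarrow> bool" where
  "qm_equivalent \<phi> \<psi> \<longleftrightarrow> bounded (range (\<lambda>g. \<phi> g - \<psi> g))"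

definition antisymmetric :: "('a::group_add \<Rightarrow> real) \<Rightarrow> bool" where
  "antisymmetric \<phi> \<longleftrightarrow> (\<forall>g. \<phi> (- g) = - \<phi> g)"

definition symmetric_pmf :: "'a::group_add pmf \<Rightarrow> bool" where
  "symmetric_pmf p \<longleftrightarrow> (\<forall>g. pmf p (- g) = pmf p g)"

definition p_integrable :: "'a pmf \<Rightarrow> ('a \<Rightarrow> real) \<Rightarrow> bool" where
  "p_integrable p \<phi> \<longleftrightarrow> (\<lambda>g. pmf p g * \<bar>\<phi> g\<bar>) summable_on UNIV"

definition Fo :: "('a::group_add \<Rightarrow> real) set" where
  "Fo = {\<phi>. \<phi> 0 = 0}"

definition act :: "'a::group_add \<Rightarrow> ('a \<Rightarrow> real) \<Rightarrow> ('a \<Rightarrow> real)" where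
  "act g \<phi> = (\<lambda>h. \<phi> (h + g) - \<phi> g)"

text \<open>The type class topology on \<open>'a \<Rightarrow> real\<close> is the product topology; \<open>Fo\<close> carries the
  subspace topology.\<close>

definition orbit_closure :: "('a::group_add \<Rightarrow> real) \<Rightarrow> ('a \<Rightarrow> real) set" where
  "orbit_closure \<phi> = top_of_set Fo closure_of range (\<lambda>g. act g \<phi>)"

definition borel_prob_on :: "'b::topological_space set \<Rightarrow> 'b measure \<Rightarrow> bool" where
  "borel_prob_on X \<nu> \<longleftrightarrow> prob_space \<nu> \<and> sets \<nu> = sets (restrict_space borel X)"

text \<open>The convolution \<open>p * \<nu>\<close> is the image of the product measure under the action map.\<close>

definition convolve :: "'a::group_add pmf \<Rightarrow> ('a \<Rightarrow> real) measure \<Rightarrow> ('a \<Rightarrow> real) measure" where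
  "convolve p \<nu> = distr (measure_pmf p \<Otimes>\<^sub>M \<nu>) \<nu> (\<lambda>(g, \<phi>). act g \<phi>)"

definition stationary :: "'a::group_add pmf \<Rightarrow> ('a \<Rightarrow> real) measure \<Rightarrow> bool" where
  "stationary p \<nu> \<longleftrightarrow> convolve p \<nu> = \<nu>"

definition ergodic :: "('a::group_add \<Rightarrow> real) measure \<Rightarrow> bool" where
  "ergodic \<nu> \<longleftrightarrow>
     (\<forall>A\<in>sets \<nu>. (\<forall>g. act g -` A \<inter> space \<nu> = A) \<longrightarrow> measure \<nu> A = 0 \<or> measure \<nu> A = 1)"

definition ergodic_stationary_measures ::
  "'a::group_add pmf \<Rightarrow> ('a \<Rightarrow> real) set \<Rightarrow> ('a \<Rightarrow> real) measure set" where
  "ergodic_stationary_measures p X = {\<nu>. borel_prob_on X \<nu> \<and> stationary p \<nu> \<and> ergodic \<nu>}"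

end

theory Submission
  imports Defs
begin

text \<open>
  Only the parity of \<open>\<phi>\<^sub>1\<close> matters.  Rounding \<open>\<phi>\<^sub>o\<close> to even integers and adding the indicator of a
  suitable set \<open>A\<close> changes \<open>\<phi>\<^sub>o\<close> by a bounded amount, and \<open>A\<close> can be chosen such that every finite
  pattern of parities occurs in some translate of \<open>\<phi>\<^sub>1\<close> (\<open>generic_subset_exists\<close>).  If \<open>\<Gamma>\<close> maps
  onto the integers by \<open>f\<close>, all patterns can be planted inside \<open>{f > 0}\<close>, which leaves room for
  continuing \<open>\<phi>\<^sub>1\<close> antisymmetrically.

  Let \<open>X\<close> be the orbit closure of such a \<open>\<phi>\<^sub>1\<close>.  It is compact and consists of integer-valued
  functions.  Fix \<open>t\<close> in \<open>(0, 1/2)\<close> and let \<open>K\<^sub>t\<close> be the set of stationary probability measures on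
  \<open>X\<close> under which the parities of a random \<open>\<psi>\<close>, taken up to a global flip, are distributed like a
  Bernoulli field with parameter \<open>t\<close>.  Different \<open>t\<close> give disjoint sets \<open>K\<^sub>t\<close>, so it suffices to
  find an ergodic measure in each \<open>K\<^sub>t\<close>.

  \<^item> \<open>K\<^sub>t\<close> is nonempty.  As all patterns occur in the orbit, finitely supported measures on the orbit
    have the correct pattern distribution on larger and larger windows.  A weak limit of them has it
    on all windows (\<open>pattern_measure_exists\<close>), and a weak limit of the Cesaro means of its
    convolution powers is in addition stationary (\<open>stationary_solution_exists\<close>).
  \<^item> \<open>K\<^sub>t\<close> has an extreme point, namely any maximizer of the strictly convex weakly continuous
    functional \<open>\<nu> \<mapsto> \<Sum>\<^sub>n 2\<^sup>-\<^sup>n \<nu>(C\<^sub>n)\<^sup>2\<close>, where \<open>C\<^sub>n\<close> enumerates the cylinders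
    (\<open>extreme_solution_exists\<close>).
  \<^item> An extreme point is ergodic.  Let \<open>\<nu>\<close> belong to \<open>K\<^sub>t\<close>, let \<open>A\<close> be an invariant event and \<open>C\<close> a
    pattern event of probability \<open>q\<close>.  The function \<open>u(g) = \<nu>(A \<inter> g\<^sup>-\<^sup>1 C)\<close> is bounded and harmonic
    for the random walk.  Translates of \<open>C\<close> with disjoint windows are independent, so by
    orthogonality \<open>u\<close> exceeds \<open>\<nu>(A) q + \<epsilon>\<close> only at finitely many \<open>g\<close>; the maximum principle on the
    infinite group gives \<open>u \<le> \<nu>(A) q\<close> (\<open>invariant_measure_le\<close>).  The same bound for the complement
    of \<open>A\<close> forces equality.  Hence conditioning \<open>\<nu>\<close> on \<open>A\<close> stays inside \<open>K\<^sub>t\<close>, and an invariant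
    event of probability strictly between 0 and 1 would split the extreme point.
\<close>

section \<open>Weak sequential compactness\<close>

text \<open>
  The injection \<open>T\<close> turns the compact space \<open>X\<close> into a compact set of reals, so that Helly's theorem
  yields sequential compactness of the probability measures on \<open>X\<close> in the weak topology.
\<close>

lemma borel_prob_on_sequentially_compact:
  fixes X :: "'b::metric_space set" and T :: "'b \<Rightarrow> real" and \<nu> :: "nat \<Rightarrow> 'b measure"
  assumes X: "compact X" and T: "continuous_on X T" "inj_on T X"
    and \<nu>: "\<And>n. borel_prob_on X (\<nu> n)"
  obtains r \<mu> where "strict_mono (r :: nat \<Rightarrow> nat)" "borel_prob_on X \<mu>"
    "\<And>f :: 'b \<Rightarrow> real. continuous_on X f \<Longrightarrow>
       (\<lambda>n. integral\<^sup>L (\<nu> (r n)) f) \<longlonglongrightarrow> integral\<^sup>L \<mu> f"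
proof -
  define E where "E = T ` X"
  define S where "S = inv_into X T"
  have prob: "prob_space (\<nu> n)" and sets: "sets (\<nu> n) = sets (restrict_space borel X)" for n
    using \<nu> by (auto simp: borel_prob_on_def)
  have space: "space (\<nu> n) = X" for n
    using sets_eq_imp_space_eq[OF sets[of n]] by (simp add: space_restrict_space)
  have X_ne: "X \<noteq> {}"
    using prob_space.not_empty[OF prob[of 0]] space by auto
  then obtain x0 where x0: "x0 \<in> X" by auto
  have E: "compact E" "closed E" "E \<noteq> {}"
    using X T X_ne by (auto simp: E_def compact_continuous_image compact_imp_closed)
  have S: "continuous_on E S" "\<And>x. x \<in> X \<Longrightarrow> S (T x) = x" "\<And>y. y \<in> E \<Longrightarrow> S y \<in> X"
    "\<And>y. y \<in> E \<Longrightarrow> T (S y) = y"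
    using T X continuous_on_inv[OF T(1) X, of S]
    by (auto simp: E_def S_def inv_into_into f_inv_into_f)
  have T_meas: "T \<in> borel_measurable (\<nu> n)" for n
    using borel_measurable_continuous_on_restrict[OF T(1)] measurable_cong_sets[OF sets] by blast
  define R where "R n = distr (\<nu> n) borel T" for n
  have R: "real_distribution (R n)" for n
    unfolding R_def by (intro prob_space.real_distribution_distr prob T_meas)
  obtain B where B: "\<And>y. y \<in> E \<Longrightarrow> \<bar>y\<bar> \<le> B"
    using compact_imp_bounded[OF E(1)] by (auto simp: bounded_iff)
  have B0: "B \<ge> 0" using B E(3) by force
  have "tight R"
    unfolding tight_def
  proof (intro conjI allI impI R)
    fix e :: real assume e: "e > 0"
    have "measure (R n) {-B-1<..B} = 1" for n
    proof -
      interpret prob_space "\<nu> n" by (rule prob)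
      have "measure (R n) {-B-1<..B} = measure (\<nu> n) (T -` {-B-1<..B} \<inter> space (\<nu> n))"
        unfolding R_def by (rule measure_distr) (use T_meas in auto)
      also have "T -` {-B-1<..B} \<inter> space (\<nu> n) = space (\<nu> n)"
        using B by (force simp: space E_def abs_le_iff)
      finally show ?thesis by (simp add: prob_space)
    qed
    with e B0 show "\<exists>a b. a < b \<and> (\<forall>n. 1 - e < measure (R n) {a<..b})"
      by (intro exI[of _ "-B-1"] exI[of _ B]) auto
  qed
  then obtain r M where r: "strict_mono (r :: nat \<Rightarrow> nat)"
    and M: "real_distribution M" "weak_conv_m (R \<circ> r) M"
    using tight_imp_convergent_subsubsequence[of R id] by (auto simp: strict_mono_id)
  interpret M: real_distribution M by fact
  have conv: "(\<lambda>n. integral\<^sup>L (R (r n)) g) \<longlonglongrightarrow> integral\<^sup>L M g"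
    if "\<And>x. isCont g x" "\<And>x. \<bar>g x\<bar> \<le> C" for g :: "real \<Rightarrow> real" and C
    using weak_conv_imp_integral_bdd_continuous_conv[of "R \<circ> r" M g C] that R M by simp
  have intR: "integral\<^sup>L (R n) g = (\<integral>x. g (T x) \<partial>\<nu> n)"
    if "g \<in> borel_measurable borel" for g :: "real \<Rightarrow> real" and n
    unfolding R_def by (rule integral_distr) (use T_meas that in auto)
  \<comment> \<open>Testing against the truncated distance to \<open>T ` X\<close> shows that the limit lives there.\<close>
  have AE_E: "AE y in M. y \<in> E"
  proof -
    define h where "h y = min 1 (infdist y E)" for y
    have h_cont: "isCont h y" for y
      unfolding h_def by (intro continuous_intros continuous_min)
    have h_bd: "\<bar>h y\<bar> \<le> 1" "0 \<le> h y" for y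
      unfolding h_def using infdist_nonneg[of y E] by auto
    have h_meas [measurable]: "h \<in> borel_measurable borel"
      using h_cont by (intro borel_measurable_continuous_onI) (auto simp: continuous_on_eq_continuous_at)
    have "integral\<^sup>L (R n) h = 0" for n
    proof -
      have "integral\<^sup>L (R n) h = (\<integral>x. 0 \<partial>\<nu> n)"
        unfolding intR[OF h_meas] by (rule Bochner_Integration.integral_cong) (auto simp: space h_def E_def)
      then show ?thesis by simp
    qed
    then have "integral\<^sup>L M h = 0"
      using conv[OF h_cont h_bd(1)] LIMSEQ_unique[OF _ tendsto_const] by fastforce
    moreover have "integrable M h"
      by (rule M.integrable_const_bound[of _ 1]) (use h_bd in auto)
    ultimately have "AE y in M. h y = 0"
      using integral_nonneg_eq_0_iff_AE[of M h] h_bd by auto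
    then show ?thesis
      by eventually_elim (use E in \<open>auto simp: h_def min_def in_closed_iff_infdist_zero split: if_splits\<close>)
  qed
  define S' where "S' y = (if y \<in> E then S y else x0)" for y
  have S'_meas: "S' \<in> measurable M (restrict_space borel X)"
    unfolding S'_def
    by (rule measurable_restrict_space2)
      (use S x0 E in \<open>auto intro!: borel_measurable_continuous_on_if simp: M.events_eq_borel cong: measurable_cong_sets\<close>)
  define \<mu> where "\<mu> = distr M (restrict_space borel X) S'"
  have "prob_space \<mu>"
    unfolding \<mu>_def by (rule M.prob_space_distr[OF S'_meas])
  then have "borel_prob_on X \<mu>"
    by (simp add: borel_prob_on_def \<mu>_def)
  moreover have "(\<lambda>n. integral\<^sup>L (\<nu> (r n)) f) \<longlonglongrightarrow> integral\<^sup>L \<mu> f"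
    if f: "continuous_on X f" for f :: "'b \<Rightarrow> real"
  proof -
    obtain C where C: "\<And>x. x \<in> X \<Longrightarrow> norm (f x) \<le> C" "C \<ge> 0"
      using compact_imp_bounded[OF compact_continuous_image[OF f X]] X_ne
      by (fastforce simp: bounded_iff intro: order_trans[OF norm_ge_zero])
    have "continuous_on E (f \<circ> S)"
      using S by (intro continuous_on_compose) (auto intro: continuous_on_subset[OF f])
    then obtain g where g: "continuous_on UNIV g" "\<And>y. y \<in> E \<Longrightarrow> g y = f (S y)" "\<And>y. norm (g y) \<le> C"
      using Tietze[of E "f \<circ> S" UNIV C] C S(3) E(2) by auto
    have g_meas: "g \<in> borel_measurable borel"
      using g(1) by (rule borel_measurable_continuous_onI)
    have "integral\<^sup>L (R n) g = integral\<^sup>L (\<nu> n) f" for n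
      unfolding intR[OF g_meas]
      by (rule Bochner_Integration.integral_cong) (auto simp: space g S E_def)
    moreover have "integral\<^sup>L M g = integral\<^sup>L \<mu> f"
    proof -
      have "integral\<^sup>L \<mu> f = (\<integral>y. f (S' y) \<partial>M)"
        unfolding \<mu>_def
        by (rule integral_distr) (use S'_meas f in \<open>auto intro: borel_measurable_continuous_on_restrict\<close>)
      also have "\<dots> = integral\<^sup>L M g"
      proof (rule integral_cong_AE)
        show "(\<lambda>y. f (S' y)) \<in> borel_measurable M"
          using measurable_comp[OF S'_meas borel_measurable_continuous_on_restrict[OF f]] by (simp add: comp_def)
        show "AE y in M. f (S' y) = g y"
          using AE_E by eventually_elim (simp add: S'_def g)
      qed (use g_meas in simp)
      finally show ?thesis by simp
    qed
    ultimately show ?thesis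
      using conv[of g C] g by (simp add: continuous_on_eq_continuous_at)
  qed
  ultimately show ?thesis using that r by blast
qed

text \<open>Ternary expansions with digits 0 and 1 are unique, as in the Cantor set.\<close>

lemma ternary_digits_inj:
  fixes a b :: "nat \<Rightarrow> bool"
  assumes "(\<Sum>n. (1/3)^n * of_bool (a n) :: real) = (\<Sum>n. (1/3)^n * of_bool (b n))"
  shows "a = b"
proof (rule ccontr)
  assume "a \<noteq> b"
  then have "\<exists>n. a n \<noteq> b n" by auto
  define N where "N = (LEAST n. a n \<noteq> b n)"
  have N: "a N \<noteq> b N" "\<And>n. n < N \<Longrightarrow> a n = b n"
    using LeastI_ex[OF \<open>\<exists>n. a n \<noteq> b n\<close>] not_less_Least unfolding N_def by blast+
  define d :: "nat \<Rightarrow> real" where "d n = of_bool (a n) - of_bool (b n)" for n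
  have d: "\<bar>d n\<bar> \<le> 1" for n by (auto simp: d_def)
  have s: "summable (\<lambda>n. (1/3)^n * c n :: real)" if "\<And>n. \<bar>c n\<bar> \<le> 1" for c :: "nat \<Rightarrow> real"
    by (rule summable_comparison_test[of _ "\<lambda>n. (1/3)^n"])
      (use that in \<open>auto simp: abs_mult summable_geometric intro!: exI[of _ 0] mult_left_le\<close>)
  have "(\<Sum>n. (1/3)^n * d n) = 0"
    using assms suminf_diff[OF s[of "\<lambda>n. of_bool (a n)"] s[of "\<lambda>n. of_bool (b n)"]]
    by (simp add: d_def algebra_simps)
  then have "0 = (\<Sum>n. (1/3)^(n+Suc N) * d (n+Suc N)) + (\<Sum>n<Suc N. (1/3)^n * d n)"
    using suminf_split_initial_segment[OF s[of d], of "Suc N"] d by simp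
  also have "(\<Sum>n<Suc N. (1/3)^n * d n) = (1/3)^N * d N"
    using N(2) by (simp add: d_def)
  finally have eq: "(1/3)^N * d N = - (\<Sum>n. (1/3)^(n+Suc N) * d (n+Suc N))"
    by linarith
  have geo: "summable (\<lambda>n. (1/3::real)^n)" by (simp add: summable_geometric)
  have geo': "summable (\<lambda>n. (1/3::real)^(n+Suc N))"
    by (rule summable_ignore_initial_segment[OF geo])
  have le: "\<bar>(1/3)^(n+Suc N) * d (n+Suc N)\<bar> \<le> (1/3)^(n+Suc N)" for n
    unfolding abs_mult using mult_left_le[OF d[of "n+Suc N"], of "(1/3)^(n+Suc N)"] by simp
  have abs: "summable (\<lambda>n. \<bar>(1/3)^(n+Suc N) * d (n+Suc N)\<bar>)"
    by (rule summable_comparison_test[OF _ geo']) (use le in auto)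
  have "(1/3)^N = \<bar>(1/3)^N * d N\<bar>"
    using N(1) by (auto simp: d_def abs_mult)
  also have "\<dots> = \<bar>\<Sum>n. (1/3)^(n+Suc N) * d (n+Suc N)\<bar>"
    by (simp only: eq abs_minus_cancel)
  also have "\<dots> \<le> (\<Sum>n. \<bar>(1/3)^(n+Suc N) * d (n+Suc N)\<bar>)"
    by (rule summable_rabs[OF abs])
  also have "\<dots> \<le> (\<Sum>n. (1/3)^(n+Suc N))"
    by (rule suminf_le[OF le abs geo'])
  also have "\<dots> = (\<Sum>n. (1/3)^n * (1/3)^Suc N)"
    by (simp only: power_add)
  also have "\<dots> = (\<Sum>n. (1/3)^n) * (1/3)^Suc N"
    by (rule suminf_mult2[OF geo, symmetric])
  also have "\<dots> = (1/3)^N / 2"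
    using suminf_geometric[of "1/3::real"] by simp
  finally show False by simp
qed

section \<open>Compact systems of integer-valued functions\<close>

text \<open>Membership in \<open>C\<close> depends only on the coordinates in \<open>F\<close>.\<close>

definition determined_on :: "'a set \<Rightarrow> ('a \<Rightarrow> real) set \<Rightarrow> bool" where
  "determined_on F C \<longleftrightarrow> (\<forall>\<psi> \<psi>'. (\<forall>h\<in>F. \<psi> h = \<psi>' h) \<longrightarrow> (\<psi> \<in> C \<longleftrightarrow> \<psi>' \<in> C))"

text \<open>
  Events that depend on finitely many coordinates.  On a set of integer-valued functions they are
  clopen, hence their measures pass to weak limits.
\<close>

definition local_event :: "('a \<Rightarrow> real) set \<Rightarrow> bool" where
  "local_event C \<longleftrightarrow> (\<exists>F. finite F \<and> determined_on F C)"

text \<open>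
  Cylinders are indexed by lists, so that there are countably many of them; an inconsistent list
  denotes the empty event.
\<close>

definition cylinder :: "('a \<times> int) list \<Rightarrow> ('a \<Rightarrow> real) set" where
  "cylinder l = {\<psi>. \<forall>(h, k)\<in>set l. \<psi> h = of_int k}"

lemma local_event_cylinder: "local_event (cylinder l)"
  unfolding local_event_def determined_on_def cylinder_def
proof (intro exI[of _ "fst ` set l"] conjI allI impI)
  fix \<psi> \<psi>' :: "'a \<Rightarrow> real"
  assume "\<forall>h\<in>fst ` set l. \<psi> h = \<psi>' h"
  then have "\<psi> h = \<psi>' h" if "(h, k) \<in> set l" for h k using that by force
  then show "\<psi> \<in> {\<psi>. \<forall>(h, k)\<in>set l. \<psi> h = of_int k} \<longleftrightarrow>
      \<psi>' \<in> {\<psi>. \<forall>(h, k)\<in>set l. \<psi> h = of_int k}"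
    by (simp add: case_prod_beta split: prod.splits) (metis prod.collapse)
qed simp

lemma cylinder_append: "cylinder (l @ l') = cylinder l \<inter> cylinder l'"
  by (simp add: cylinder_def ball_Un Collect_conj_eq)

lemma local_event_act: "local_event C \<Longrightarrow> local_event (act g -` C)"
proof -
  assume "local_event C"
  then obtain F where F: "finite F" "determined_on F C" by (auto simp: local_event_def)
  have "determined_on (insert g ((\<lambda>h. h + g) ` F)) (act g -` C)"
    unfolding determined_on_def
  proof (intro allI impI)
    fix \<psi> \<psi>' :: "'a \<Rightarrow> real"
    assume "\<forall>h\<in>insert g ((\<lambda>h. h + g) ` F). \<psi> h = \<psi>' h"
    then have "\<forall>h\<in>F. act g \<psi> h = act g \<psi>' h" by (simp add: act_def)
    with F(2) show "\<psi> \<in> act g -` C \<longleftrightarrow> \<psi>' \<in> act g -` C"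
      unfolding determined_on_def vimage_eq by blast
  qed
  with F(1) show ?thesis
    unfolding local_event_def by (intro exI[of _ "insert g ((\<lambda>h. h + g) ` F)"]) simp
qed

lemma act_act: "act g (act g' \<psi>) = act (g + g') \<psi>"
  by (simp add: act_def add.assoc fun_eq_iff)

lemma continuous_on_act: "continuous_on A (act g)"
  unfolding act_def
proof (rule continuous_on_coordinatewise_then_product)
  fix h
  have "continuous_on A (\<lambda>\<psi>. \<psi> k)" for k
    by (rule continuous_on_subset[OF continuous_on_product_coordinates]) simp
  from continuous_on_diff[OF this this]
  show "continuous_on A (\<lambda>\<psi>. \<psi> (h + g) - \<psi> g)" .
qed

text \<open>A compact invariant set of integer-valued functions.\<close>

locale integral_system =
  fixes X :: "('a::{group_add, countable} \<Rightarrow> real) set"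
  assumes compact: "compact X"
    and Ints: "\<psi> \<in> X \<Longrightarrow> \<psi> h \<in> \<int>"
    and act_closed: "\<psi> \<in> X \<Longrightarrow> act g \<psi> \<in> X"
begin

abbreviation BX :: "('a \<Rightarrow> real) measure" where
  "BX \<equiv> restrict_space borel X"

lemma space_BX [simp]: "space BX = X"
  by (simp add: space_restrict_space)

lemma borel_prob_onD:
  assumes "borel_prob_on X \<nu>"
  shows "prob_space \<nu>" "sets \<nu> = sets BX" "space \<nu> = X"
  using assms sets_eq_imp_space_eq[of \<nu> BX] by (auto simp: borel_prob_on_def)

lemma continuous_on_indicator_local:
  assumes "local_event C"
  shows "continuous_on X (indicator C :: _ \<Rightarrow> real)"
  unfolding continuous_on_def
proof
  fix \<psi> assume \<psi>: "\<psi> \<in> X"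
  obtain F where F: "finite F" "determined_on F C"
    using assms by (auto simp: local_event_def)
  have "\<forall>\<^sub>F \<psi>' in at \<psi> within X. \<forall>h\<in>F. dist (\<psi>' h) (\<psi> h) < 1"
  proof (rule eventually_ball_finite[OF F(1)], rule ballI)
    fix h
    have "((\<lambda>\<psi>. \<psi> h) \<longlongrightarrow> \<psi> h) (at \<psi> within X)"
      using \<psi> continuous_on_subset[OF continuous_on_product_coordinates[of h], of X]
      by (auto simp: continuous_on_def)
    then show "\<forall>\<^sub>F \<psi>' in at \<psi> within X. dist (\<psi>' h) (\<psi> h) < 1"
      by (rule tendstoD) simp
  qed
  moreover have "\<forall>\<^sub>F \<psi>' in at \<psi> within X. \<psi>' \<in> X"
    by (simp add: eventually_at_filter)
  ultimately have "\<forall>\<^sub>F \<psi>' in at \<psi> within X. indicator C \<psi>' = (indicator C \<psi> :: real)"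
  proof eventually_elim
    case (elim \<psi>')
    have "\<psi>' h = \<psi> h" if "h \<in> F" for h
    proof -
      from Ints[OF \<psi>, of h] Ints[OF elim(2), of h]
      obtain i j where "\<psi> h = of_int i" "\<psi>' h = of_int j" by (auto elim!: Ints_cases)
      with elim(1) that have "\<bar>real_of_int (j - i)\<bar> < 1" by (auto simp: dist_real_def)
      then have "j = i" by linarith
      with \<open>\<psi> h = of_int i\<close> \<open>\<psi>' h = of_int j\<close> show ?thesis by simp
    qed
    then show ?case using F(2) by (auto simp: determined_on_def indicator_def)
  qed
  then show "(indicator C \<longlongrightarrow> (indicator C \<psi> :: real)) (at \<psi> within X)"
    by (rule tendsto_eventually)
qed

lemma sets_local:
  assumes "local_event C" shows "X \<inter> C \<in> sets BX"
proof -
  have "(indicator C :: _ \<Rightarrow> real) -` {1} \<inter> space BX \<in> sets BX"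
    by (rule measurable_sets[OF borel_measurable_continuous_on_restrict])
      (auto intro: continuous_on_indicator_local assms)
  also have "(indicator C :: _ \<Rightarrow> real) -` {1} \<inter> space BX = X \<inter> C"
    by (auto simp: indicator_def)
  finally show ?thesis .
qed

text \<open>The ternary digits of the image record which cylinders contain the function.\<close>

lemma continuous_injection_into_real:
  obtains T :: "('a \<Rightarrow> real) \<Rightarrow> real" where "continuous_on X T" "inj_on T X"
proof
  define c where "c n = cylinder (from_nat n :: ('a \<times> int) list)" for n
  define T :: "('a \<Rightarrow> real) \<Rightarrow> real" where "T \<psi> = (\<Sum>n. (1/3)^n * of_bool (\<psi> \<in> c n))" for \<psi>
  show "continuous_on X T"
  proof (rule uniform_limit_theorem)
    show "uniform_limit X (\<lambda>n \<psi>. \<Sum>i<n. (1/3)^i * of_bool (\<psi> \<in> c i)) T sequentially"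
      unfolding T_def by (rule Weierstrass_m_test[of _ _ "\<lambda>n. (1/3)^n"]) (auto simp: summable_geometric)
    have "continuous_on X (\<lambda>\<psi>. \<Sum>i<n. (1/3)^i * indicator (c i) \<psi> :: real)" for n
      unfolding c_def
      by (intro continuous_intros continuous_on_indicator_local local_event_cylinder)
    then show "\<forall>\<^sub>F n in sequentially. continuous_on X (\<lambda>\<psi>. \<Sum>i<n. (1/3)^i * of_bool (\<psi> \<in> c i) :: real)"
      by (simp add: indicator_def of_bool_def)
  qed simp
  show "inj_on T X"
  proof (rule inj_onI, rule ext)
    fix \<psi> \<psi>' h assume *: "\<psi> \<in> X" "\<psi>' \<in> X" "T \<psi> = T \<psi>'"
    obtain k where k: "\<psi> h = of_int k" using Ints[OF *(1), of h] by (auto elim: Ints_cases)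
    have "(\<lambda>n. \<psi> \<in> c n) = (\<lambda>n. \<psi>' \<in> c n)"
      using *(3) unfolding T_def by (rule ternary_digits_inj)
    then have "\<psi> \<in> c (to_nat [(h, k)]) \<longleftrightarrow> \<psi>' \<in> c (to_nat [(h, k)])" by meson
    with k show "\<psi> h = \<psi>' h" by (simp add: c_def cylinder_def)
  qed
qed

lemma sequentially_compact_local:
  assumes "\<And>n. borel_prob_on X (\<nu> n)"
  obtains r \<mu> where "strict_mono (r :: nat \<Rightarrow> nat)" "borel_prob_on X \<mu>"
    "\<And>C. local_event C \<Longrightarrow> (\<lambda>n. measure (\<nu> (r n)) (X \<inter> C)) \<longlonglongrightarrow> measure \<mu> (X \<inter> C)"
proof -
  obtain T :: "('a \<Rightarrow> real) \<Rightarrow> real" where "continuous_on X T" "inj_on T X"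
    by (rule continuous_injection_into_real)
  from borel_prob_on_sequentially_compact[OF compact this, of \<nu>] assms
  obtain r \<mu> where *: "strict_mono (r :: nat \<Rightarrow> nat)" "borel_prob_on X \<mu>"
    "\<And>f :: _ \<Rightarrow> real. continuous_on X f \<Longrightarrow>
       (\<lambda>n. integral\<^sup>L (\<nu> (r n)) f) \<longlonglongrightarrow> integral\<^sup>L \<mu> f"
    by metis
  have "(\<lambda>n. measure (\<nu> (r n)) (X \<inter> C)) \<longlonglongrightarrow> measure \<mu> (X \<inter> C)" if "local_event C" for C
    using *(3)[OF continuous_on_indicator_local[OF that]] borel_prob_onD(3)[OF assms] borel_prob_onD(3)[OF *(2)]
    by (simp add: Int_commute)
  with * that show ?thesis by blast
qed

lemma borel_prob_on_eqI:
  assumes \<mu>: "borel_prob_on X \<mu>" and \<nu>: "borel_prob_on X \<nu>"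
    and eq: "\<And>l. measure \<mu> (X \<inter> cylinder l) = measure \<nu> (X \<inter> cylinder l)"
  shows "\<mu> = \<nu>"
proof -
  let ?E = "range (\<lambda>l. X \<inter> cylinder l)"
  interpret \<mu>: prob_space \<mu> by (rule borel_prob_onD[OF \<mu>])
  interpret \<nu>: prob_space \<nu> by (rule borel_prob_onD[OF \<nu>])
  have EX: "?E \<subseteq> Pow X" by auto
  have "(\<lambda>\<psi>. \<psi>) \<in> borel_measurable (sigma X ?E)"
  proof (rule measurable_coordinatewise_then_product)
    fix h
    have eq1: "(\<lambda>\<psi>. \<psi> h) -` B \<inter> X = (\<Union>k\<in>{k. real_of_int k \<in> B}. X \<inter> cylinder [(h, k)])" for B
    proof safe
      fix \<psi> assume \<psi>: "\<psi> \<in> X" "\<psi> h \<in> B"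
      obtain k where "\<psi> h = of_int k" using Ints[OF \<psi>(1), of h] by (auto elim: Ints_cases)
      with \<psi> show "\<psi> \<in> (\<Union>k\<in>{k. real_of_int k \<in> B}. X \<inter> cylinder [(h, k)])"
        by (auto simp: cylinder_def)
    qed (simp_all add: cylinder_def)
    then show "(\<lambda>\<psi>. \<psi> h) \<in> borel_measurable (sigma X ?E)"
    proof (intro measurableI)
      fix B :: "real set"
      have "(\<Union>k\<in>{k. real_of_int k \<in> B}. X \<inter> cylinder [(h, k)]) \<in> sets (sigma X ?E)"
        using EX by (intro sets.countable_UN') (auto simp: sets_measure_of)
      then show "(\<lambda>\<psi>. \<psi> h) -` B \<inter> space (sigma X ?E) \<in> sets (sigma X ?E)"
        using EX by (simp only: eq1 space_measure_of)
    qed simp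
  qed
  then have *: "X \<inter> B \<in> sigma_sets X ?E" if "B \<in> sets borel" for B
  proof -
    assume "(\<lambda>\<psi>. \<psi>) \<in> borel_measurable (sigma X ?E)"
    from measurable_sets[OF this that] have "B \<inter> X \<in> sigma_sets X ?E"
      using EX by (simp only: space_measure_of sets_measure_of vimage_ident)
    then show ?thesis by (simp only: Int_commute)
  qed
  have "sets BX = sigma_sets X ?E"
  proof
    show "sets BX \<subseteq> sigma_sets X ?E"
      using * by (auto simp: sets_restrict_space)
    show "sigma_sets X ?E \<subseteq> sets BX"
      using sets.sigma_sets_subset[of ?E BX] sets_local[OF local_event_cylinder] by auto
  qed
  then have sets: "sets \<mu> = sigma_sets X ?E" "sets \<nu> = sigma_sets X ?E"
    using borel_prob_onD(2)[OF \<mu>] borel_prob_onD(2)[OF \<nu>] by auto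
  show ?thesis
  proof (rule measure_eqI_generator_eq[OF _ EX _ sets, of "\<lambda>_. X"])
    show "Int_stable ?E"
      unfolding Int_stable_def
    proof safe
      fix l l' :: "('a \<times> int) list"
      have "(X \<inter> cylinder l) \<inter> (X \<inter> cylinder l') = X \<inter> cylinder (l @ l')"
        by (auto simp: cylinder_append)
      then show "(X \<inter> cylinder l) \<inter> (X \<inter> cylinder l') \<in> ?E" by blast
    qed
    show "range (\<lambda>_::nat. X) \<subseteq> ?E"
      by (auto simp: cylinder_def intro!: image_eqI[of _ _ "[]"])
  qed (use eq in \<open>auto simp: \<mu>.emeasure_eq_measure \<nu>.emeasure_eq_measure\<close>)
qed

lemma measurable_act: "act g \<in> measurable BX BX"
  by (rule measurable_restrict_space2)
    (auto intro: borel_measurable_continuous_on_restrict continuous_on_act act_closed)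

text \<open>Convolution averages the pulled back event over the step distribution \<open>q\<close>.\<close>

lemma convolve:
  fixes q :: "'a pmf"
  assumes \<nu>: "borel_prob_on X \<nu>"
  shows borel_prob_on_convolve: "borel_prob_on X (convolve q \<nu>)"
    and measure_convolve: "C \<in> sets BX \<Longrightarrow>
      measure (convolve q \<nu>) C = (\<integral>g. measure \<nu> (act g -` C \<inter> X) \<partial>measure_pmf q)"
proof -
  interpret \<nu>: prob_space \<nu> by (rule borel_prob_onD[OF \<nu>])
  interpret pair_prob_space "measure_pmf q" \<nu> ..
  have sets: "sets \<nu> = sets BX" and space: "space \<nu> = X"
    using borel_prob_onD[OF \<nu>] by auto
  have "(\<lambda>(g, \<phi>). act g \<phi>) \<in> measurable (count_space UNIV \<Otimes>\<^sub>M \<nu>) \<nu>"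
    using measurable_act
    by (intro measurable_pair_measure_countable1) (auto cong: measurable_cong_sets simp: sets)
  moreover have "sets (measure_pmf q \<Otimes>\<^sub>M \<nu>) = sets (count_space UNIV \<Otimes>\<^sub>M \<nu>)"
    by (intro sets_pair_measure_cong) auto
  ultimately have meas: "(\<lambda>(g, \<phi>). act g \<phi>) \<in> measurable (measure_pmf q \<Otimes>\<^sub>M \<nu>) \<nu>"
    using measurable_cong_sets by blast
  have ps: "prob_space (convolve q \<nu>)"
    unfolding convolve_def by (rule prob_space_distr[OF meas])
  then show "borel_prob_on X (convolve q \<nu>)"
    using sets by (simp add: borel_prob_on_def convolve_def)
  interpret c: prob_space "convolve q \<nu>" by fact
  assume C: "C \<in> sets BX"
  have "emeasure (convolve q \<nu>) C =
      emeasure (measure_pmf q \<Otimes>\<^sub>M \<nu>) ((\<lambda>(g, \<phi>). act g \<phi>) -` C \<inter> space (measure_pmf q \<Otimes>\<^sub>M \<nu>))"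
    unfolding convolve_def by (rule emeasure_distr[OF meas]) (simp add: C sets)
  also have "\<dots> = (\<integral>\<^sup>+g. emeasure \<nu> (Pair g -` ((\<lambda>(g, \<phi>). act g \<phi>) -` C \<inter> space (measure_pmf q \<Otimes>\<^sub>M \<nu>))) \<partial>measure_pmf q)"
    by (rule \<nu>.emeasure_pair_measure_alt) (use measurable_sets[OF meas] C sets in auto)
  also have "\<dots> = (\<integral>\<^sup>+g. ennreal (measure \<nu> (act g -` C \<inter> X)) \<partial>measure_pmf q)"
    by (intro nn_integral_cong)
      (auto simp: \<nu>.emeasure_eq_measure space_pair_measure space intro!: arg_cong[of _ _ "measure \<nu>"])
  also have "\<dots> = ennreal (\<integral>g. measure \<nu> (act g -` C \<inter> X) \<partial>measure_pmf q)"
    by (intro nn_integral_eq_integral measure_pmf.integrable_const_bound[of _ 1]) auto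
  finally show "measure (convolve q \<nu>) C = (\<integral>g. measure \<nu> (act g -` C \<inter> X) \<partial>measure_pmf q)"
    by (simp add: c.emeasure_eq_measure integral_nonneg_AE)
qed

lemma stationaryD:
  assumes "borel_prob_on X \<nu>" "stationary p \<nu>" "C \<in> sets BX"
  shows "measure \<nu> C = (\<integral>g. measure \<nu> (act g -` C \<inter> X) \<partial>measure_pmf p)"
  using measure_convolve[OF assms(1,3), of p] assms(2) by (simp add: stationary_def)

text \<open>
  Stationarity need only be tested on local events, because these determine a measure on \<open>X\<close>.
\<close>

lemma stationaryI:
  assumes "borel_prob_on X \<nu>"
    and "\<And>C. local_event C \<Longrightarrow>
      measure \<nu> (X \<inter> C) = (\<integral>g. measure \<nu> (X \<inter> act g -` C) \<partial>measure_pmf p)"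
  shows "stationary p \<nu>"
  unfolding stationary_def
proof (rule borel_prob_on_eqI[OF borel_prob_on_convolve[OF assms(1)] assms(1)])
  fix l
  have "act g -` (X \<inter> cylinder l) \<inter> X = X \<inter> act g -` cylinder l" for g
    using act_closed by auto
  then show "measure (convolve p \<nu>) (X \<inter> cylinder l) = measure \<nu> (X \<inter> cylinder l)"
    using assms(2)[OF local_event_cylinder, of l]
    by (simp add: measure_convolve[OF assms(1)] sets_local[OF local_event_cylinder])
qed

end

section \<open>Stationary measures with prescribed local probabilities\<close>

context integral_system
begin

text \<open>The left-hand side is the form to which the simplifier brings \<open>act g -` (X \<inter> C) \<inter> X\<close>.\<close>

lemma vimage_act_Int: "act g -` X \<inter> act g -` C \<inter> X = X \<inter> act g -` C"
  using act_closed by auto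

lemma mixture:
  fixes q :: "nat pmf"
  assumes \<nu>: "\<And>k. borel_prob_on X (\<nu> k)"
  obtains \<mu> where "borel_prob_on X \<mu>"
    "\<And>C. C \<in> sets BX \<Longrightarrow> measure \<mu> C = (\<integral>k. measure (\<nu> k) C \<partial>measure_pmf q)"
proof
  let ?\<mu> = "measure_pmf q \<bind> \<nu>"
  have ps: "prob_space (\<nu> k)" and sets: "sets (\<nu> k) = sets BX" for k
    using borel_prob_onD[OF \<nu>] by auto
  have meas: "\<nu> \<in> measurable (measure_pmf q) (subprob_algebra BX)"
    using ps sets by (auto simp: space_subprob_algebra intro: prob_space_imp_subprob_space)
  have "prob_space ?\<mu>"
    by (rule measure_pmf.prob_space_bind[OF _ meas]) (simp add: ps)
  then interpret \<mu>: prob_space ?\<mu> .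
  show "borel_prob_on X ?\<mu>"
    unfolding borel_prob_on_def
    by (intro conjI \<open>prob_space ?\<mu>\<close> sets_bind) (simp_all add: sets)
  fix C assume C: "C \<in> sets BX"
  have "emeasure ?\<mu> C = (\<integral>\<^sup>+k. emeasure (\<nu> k) C \<partial>measure_pmf q)"
    by (rule emeasure_bind[OF _ meas C]) simp
  also have "\<dots> = (\<integral>\<^sup>+k. ennreal (measure (\<nu> k) C) \<partial>measure_pmf q)"
    by (intro nn_integral_cong finite_measure.emeasure_eq_measure prob_space.finite_measure ps)
  also have "\<dots> = ennreal (\<integral>k. measure (\<nu> k) C \<partial>measure_pmf q)"
    by (intro nn_integral_eq_integral measure_pmf.integrable_const_bound[of _ 1])
      (auto intro: prob_space.prob_le_1 ps)
  finally show "measure ?\<mu> C = (\<integral>k. measure (\<nu> k) C \<partial>measure_pmf q)"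
    by (simp add: \<mu>.emeasure_eq_measure integral_nonneg_AE)
qed

text \<open>
  It is enough for the approximating measures to be asymptotically stationary.  This covers both
  limits of stationary measures and limits of Cesaro means.
\<close>

lemma stationary_limit:
  fixes p :: "'a pmf"
  assumes \<nu>: "\<And>n. borel_prob_on X (\<nu> n)" and \<mu>: "borel_prob_on X \<mu>"
    and lim: "\<And>C. local_event C \<Longrightarrow> (\<lambda>n. measure (\<nu> n) (X \<inter> C)) \<longlonglongrightarrow> measure \<mu> (X \<inter> C)"
    and asym: "\<And>C. local_event C \<Longrightarrow>
      (\<lambda>n. (\<integral>g. measure (\<nu> n) (X \<inter> act g -` C) \<partial>measure_pmf p) - measure (\<nu> n) (X \<inter> C)) \<longlonglongrightarrow> 0"
  shows "stationary p \<mu>"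
proof (rule stationaryI[OF \<mu>])
  fix C :: "('a \<Rightarrow> real) set" assume C: "local_event C"
  have "(\<lambda>n. \<integral>g. measure (\<nu> n) (X \<inter> act g -` C) \<partial>measure_pmf p)
      \<longlonglongrightarrow> (\<integral>g. measure \<mu> (X \<inter> act g -` C) \<partial>measure_pmf p)"
  proof (rule integral_dominated_convergence[where w = "\<lambda>_. 1"])
    show "AE g in measure_pmf p. (\<lambda>n. measure (\<nu> n) (X \<inter> act g -` C)) \<longlonglongrightarrow> measure \<mu> (X \<inter> act g -` C)"
      by (intro always_eventually allI lim local_event_act C)
    show "AE g in measure_pmf p. norm (measure (\<nu> n) (X \<inter> act g -` C)) \<le> 1" for n
      using prob_space.prob_le_1[OF borel_prob_onD(1)[OF \<nu>]] by (intro always_eventually allI) simp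
  qed simp_all
  from tendsto_diff[OF this lim[OF C]]
  have "(\<integral>g. measure \<mu> (X \<inter> act g -` C) \<partial>measure_pmf p) - measure \<mu> (X \<inter> C) = 0"
    using asym[OF C] LIMSEQ_unique by blast
  then show "measure \<mu> (X \<inter> C) = (\<integral>g. measure \<mu> (X \<inter> act g -` C) \<partial>measure_pmf p)" by simp
qed

text \<open>
  A set of constraints prescribes the probabilities of certain events.  Only the part of an event
  inside \<open>X\<close> counts.
\<close>

definition satisfies :: "('a \<Rightarrow> real) measure \<Rightarrow> (('a \<Rightarrow> real) set \<times> real) set \<Rightarrow> bool" where
  "satisfies \<nu> V \<longleftrightarrow> (\<forall>(C, c)\<in>V. measure \<nu> (X \<inter> C) = c)"

text \<open>
  Prescribed values that are unchanged when an event is translated; they are inherited by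
  convolutions and, the events being local, by weak limits.
\<close>

definition invariant_constraints :: "(('a \<Rightarrow> real) set \<times> real) set \<Rightarrow> bool" where
  "invariant_constraints V \<longleftrightarrow> (\<forall>(C, c)\<in>V. local_event C \<and> (\<forall>g. (act g -` C, c) \<in> V))"

text \<open>The stationary measures on \<open>X\<close> with prescribed probabilities.\<close>

definition solutions :: "'a pmf \<Rightarrow> (('a \<Rightarrow> real) set \<times> real) set \<Rightarrow> ('a \<Rightarrow> real) measure set" where
  "solutions p V = {\<nu>. borel_prob_on X \<nu> \<and> stationary p \<nu> \<and> satisfies \<nu> V}"

lemma satisfies_limit:
  assumes "\<And>n. satisfies (\<nu> n) V" "invariant_constraints V"
    and "\<And>C. local_event C \<Longrightarrow> (\<lambda>n. measure (\<nu> n) (X \<inter> C)) \<longlonglongrightarrow> measure \<mu> (X \<inter> C)"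
  shows "satisfies \<mu> V"
  unfolding satisfies_def
proof clarify
  fix C c assume *: "(C, c) \<in> V"
  then have "(\<lambda>n. measure (\<nu> n) (X \<inter> C)) \<longlonglongrightarrow> measure \<mu> (X \<inter> C)"
    using assms(2,3) by (auto simp: invariant_constraints_def)
  moreover have "measure (\<nu> n) (X \<inter> C) = c" for n
    using assms(1)[of n] * by (auto simp: satisfies_def)
  ultimately show "measure \<mu> (X \<inter> C) = c"
    by (simp add: LIMSEQ_const_iff)
qed

lemma satisfies_convolve:
  assumes "borel_prob_on X \<nu>" "satisfies \<nu> V" "invariant_constraints V"
  shows "satisfies (convolve q \<nu>) V"
  unfolding satisfies_def
proof clarify
  fix C c assume *: "(C, c) \<in> V"
  then have C: "local_event C" "\<And>g. (act g -` C, c) \<in> V"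
    using assms(3) by (auto simp: invariant_constraints_def)
  then have "measure \<nu> (X \<inter> act g -` C) = c" for g
    using assms(2) by (fastforce simp: satisfies_def)
  then show "measure (convolve q \<nu>) (X \<inter> C) = c"
    by (simp add: measure_convolve[OF assms(1)] sets_local C(1) vimage_act_Int)
qed

text \<open>
  The limit of the Cesaro means of the convolution powers of \<open>\<nu>\<close> still satisfies the constraints.
\<close>

lemma stationary_solution_exists:
  assumes \<nu>: "borel_prob_on X \<nu>" "satisfies \<nu> V" and V: "invariant_constraints V"
  shows "solutions p V \<noteq> {}"
proof -
  define P where "P k = (convolve p ^^ k) \<nu>" for k
  have P: "borel_prob_on X (P k)" "satisfies (P k) V" for k
    by (induction k) (auto simp: P_def \<nu> V borel_prob_on_convolve satisfies_convolve)
  have P_Suc: "measure (P (Suc k)) (X \<inter> C) = (\<integral>g. measure (P k) (X \<inter> act g -` C) \<partial>measure_pmf p)"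
    if "local_event C" for k C
    using measure_convolve[OF P(1)[of k] sets_local[OF that], of p] by (simp add: P_def vimage_act_Int)
  have "\<exists>\<mu>. borel_prob_on X \<mu> \<and>
      (\<forall>C\<in>sets BX. measure \<mu> C = (\<Sum>k<Suc n. measure (P k) C) / Suc n)" for n
    by (rule mixture[of P "pmf_of_set {..<Suc n}", OF P(1)])
      (auto simp: integral_pmf_of_set lessThan_empty_iff)
  then obtain A where A: "\<And>n. borel_prob_on X (A n)"
    "\<And>n C. C \<in> sets BX \<Longrightarrow> measure (A n) C = (\<Sum>k<Suc n. measure (P k) C) / Suc n"
    by metis
  obtain r \<mu> where r: "strict_mono (r :: nat \<Rightarrow> nat)" and \<mu>: "borel_prob_on X \<mu>"
    and lim: "\<And>C. local_event C \<Longrightarrow> (\<lambda>n. measure (A (r n)) (X \<inter> C)) \<longlonglongrightarrow> measure \<mu> (X \<inter> C)"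
    using sequentially_compact_local[of A, OF A(1)] by blast
  have "satisfies (A n) V" for n
    unfolding satisfies_def
  proof clarify
    fix C c assume *: "(C, c) \<in> V"
    then have "measure (P k) (X \<inter> C) = c" "local_event C" for k
      using P(2)[of k] V by (auto simp: satisfies_def invariant_constraints_def)
    then show "measure (A n) (X \<inter> C) = c"
      by (simp add: A(2) sets_local del: sum.lessThan_Suc)
  qed
  then have "satisfies \<mu> V"
    by (intro satisfies_limit[OF _ V lim])
  moreover have "stationary p \<mu>"
  proof (rule stationary_limit[OF A(1) \<mu> lim])
    fix C :: "('a \<Rightarrow> real) set" assume C: "local_event C"
    have bd: "\<bar>measure (P k) D\<bar> \<le> 1" for k D
      using prob_space.prob_le_1[OF borel_prob_onD(1)[OF P(1)]] by simp
    have "(\<integral>g. measure (A n) (X \<inter> act g -` C) \<partial>measure_pmf p) - measure (A n) (X \<inter> C)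
        = (measure (P (Suc n)) (X \<inter> C) - measure (P 0) (X \<inter> C)) / Suc n" for n
    proof -
      have "(\<integral>g. measure (A n) (X \<inter> act g -` C) \<partial>measure_pmf p)
          = (\<integral>g. (\<Sum>k<Suc n. measure (P k) (X \<inter> act g -` C)) / Suc n \<partial>measure_pmf p)"
        by (intro Bochner_Integration.integral_cong refl A(2) sets_local local_event_act C)
      also have "\<dots> = (\<Sum>k<Suc n. \<integral>g. measure (P k) (X \<inter> act g -` C) \<partial>measure_pmf p) / Suc n"
        by (subst Bochner_Integration.integral_divide_zero, subst Bochner_Integration.integral_sum)
          (auto intro!: measure_pmf.integrable_const_bound[of _ 1] always_eventually abs_le_D1[OF bd])
      also have "\<dots> = (\<Sum>k<Suc n. measure (P (Suc k)) (X \<inter> C)) / Suc n"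
        by (simp only: P_Suc[OF C])
      finally show ?thesis
        by (simp only: A(2)[OF sets_local[OF C]] diff_divide_distrib[symmetric]
            sum_subtractf[symmetric] sum_lessThan_telescope[of "\<lambda>k. measure (P k) (X \<inter> C)"])
    qed
    moreover have "(\<lambda>n. (measure (P (Suc n)) (X \<inter> C) - measure (P 0) (X \<inter> C)) / real (Suc n)) \<longlonglongrightarrow> 0"
    proof (rule Lim_null_comparison)
      show "\<forall>\<^sub>F n in sequentially. norm ((measure (P (Suc n)) (X \<inter> C) - measure (P 0) (X \<inter> C)) / real (Suc n)) \<le> 2 * (1 / real (Suc n))"
      proof (intro always_eventually allI)
        fix n
        have "\<bar>measure (P (Suc n)) (X \<inter> C) - measure (P 0) (X \<inter> C)\<bar> \<le> 2"
          using bd[of "Suc n" "X \<inter> C"] bd[of 0 "X \<inter> C"] by linarith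
        then show "norm ((measure (P (Suc n)) (X \<inter> C) - measure (P 0) (X \<inter> C)) / real (Suc n)) \<le> 2 * (1 / real (Suc n))"
          by (simp add: abs_divide divide_right_mono)
      qed
      show "(\<lambda>n. 2 * (1 / real (Suc n))) \<longlonglongrightarrow> 0"
        using tendsto_mult_right_zero[OF LIMSEQ_inverse_real_of_nat, of 2] by (simp add: inverse_eq_divide)
    qed
    ultimately have "(\<lambda>n. (\<integral>g. measure (A n) (X \<inter> act g -` C) \<partial>measure_pmf p) - measure (A n) (X \<inter> C)) \<longlonglongrightarrow> 0"
      by simp
    from LIMSEQ_subseq_LIMSEQ[OF this r]
    show "(\<lambda>n. (\<integral>g. measure (A (r n)) (X \<inter> act g -` C) \<partial>measure_pmf p) - measure (A (r n)) (X \<inter> C)) \<longlonglongrightarrow> 0"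
      by (simp add: comp_def)
  qed
  ultimately show ?thesis using \<mu> by (auto simp: solutions_def)
qed

text \<open>
  The functional \<open>\<Phi>\<close>, a weighted sum of the squared probabilities of all cylinders, is weakly
  continuous and strictly convex, so a maximizer of \<open>\<Phi>\<close> is an extreme point.
\<close>

lemma extreme_solution_exists:
  assumes V: "invariant_constraints V" and ne: "solutions p V \<noteq> {}"
  obtains \<nu> where "\<nu> \<in> solutions p V"
    "\<And>\<nu>1 \<nu>2 a. \<nu>1 \<in> solutions p V \<Longrightarrow> \<nu>2 \<in> solutions p V \<Longrightarrow> 0 < a \<Longrightarrow> a < 1 \<Longrightarrow>
       (\<And>C. C \<in> sets BX \<Longrightarrow> measure \<nu> C = a * measure \<nu>1 C + (1 - a) * measure \<nu>2 C) \<Longrightarrow> \<nu>1 = \<nu>2"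
proof -
  let ?K = "solutions p V"
  define v where "v \<nu> n = measure \<nu> (X \<inter> cylinder (from_nat n))" for \<nu> n
  let ?G = "measure_pmf (geometric_pmf (1/2))"
  define \<Phi> where "\<Phi> \<nu> = (\<integral>n. (v \<nu> n)\<^sup>2 \<partial>?G)" for \<nu>
  have K: "borel_prob_on X \<nu>" "stationary p \<nu>" "satisfies \<nu> V" if "\<nu> \<in> ?K" for \<nu>
    using that by (auto simp: solutions_def)
  have v: "0 \<le> v \<nu> n" "v \<nu> n \<le> 1" if "\<nu> \<in> ?K" for \<nu> n
    using prob_space.prob_le_1[OF borel_prob_onD(1)[OF K(1)[OF that]]] by (auto simp: v_def)
  have v2: "norm ((v \<nu> n)\<^sup>2) \<le> 1" if "\<nu> \<in> ?K" for \<nu> n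
    using v[OF that, of n] by (simp add: power_le_one)
  have int: "integrable ?G (\<lambda>n. (v \<nu> n)\<^sup>2)" if "\<nu> \<in> ?K" for \<nu>
    by (rule measure_pmf.integrable_const_bound[of _ 1]) (use v2[OF that] in auto)
  have bdd: "bdd_above (\<Phi> ` ?K)"
  proof (rule bdd_aboveI2)
    fix \<nu> assume "\<nu> \<in> ?K"
    then show "\<Phi> \<nu> \<le> 1"
      unfolding \<Phi>_def using v2 by (intro measure_pmf.integral_le_const int) auto
  qed
  define s where "s = Sup (\<Phi> ` ?K)"
  have "\<exists>\<nu>\<in>?K. s - 1 / Suc n < \<Phi> \<nu>" for n
    using less_cSup_iff[of "\<Phi> ` ?K" "s - 1 / Suc n"] ne bdd by (auto simp: s_def)
  then obtain N where N: "\<And>n. N n \<in> ?K" "\<And>n. s - 1 / Suc n < \<Phi> (N n)" by metis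
  obtain r \<mu> where r: "strict_mono (r :: nat \<Rightarrow> nat)" and \<mu>: "borel_prob_on X \<mu>"
    and lim: "\<And>C. local_event C \<Longrightarrow> (\<lambda>n. measure (N (r n)) (X \<inter> C)) \<longlonglongrightarrow> measure \<mu> (X \<inter> C)"
    using sequentially_compact_local[of N] K(1)[OF N(1)] by blast
  have "stationary p \<mu>"
  proof (rule stationary_limit[OF K(1)[OF N(1)] \<mu> lim])
    fix C :: "('a \<Rightarrow> real) set" assume C: "local_event C"
    have "(\<integral>g. measure (N n) (X \<inter> act g -` C) \<partial>measure_pmf p) - measure (N n) (X \<inter> C) = 0" for n
      using stationaryD[OF K(1,2)[OF N(1)] sets_local[OF C], of n] by (simp add: vimage_act_Int)
    then show "(\<lambda>n. (\<integral>g. measure (N (r n)) (X \<inter> act g -` C) \<partial>measure_pmf p) - measure (N (r n)) (X \<inter> C)) \<longlonglongrightarrow> 0"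
      by simp
  qed
  moreover have "satisfies \<mu> V"
    by (rule satisfies_limit[OF K(3)[OF N(1)] V lim])
  ultimately have \<mu>K: "\<mu> \<in> ?K" using \<mu> by (simp add: solutions_def)
  have "(\<lambda>n. \<Phi> (N (r n))) \<longlonglongrightarrow> \<Phi> \<mu>"
    unfolding \<Phi>_def
  proof (rule integral_dominated_convergence[where w = "\<lambda>_. 1"])
    show "AE k in ?G. (\<lambda>n. (v (N (r n)) k)\<^sup>2) \<longlonglongrightarrow> (v \<mu> k)\<^sup>2"
      unfolding v_def by (intro always_eventually allI tendsto_power lim local_event_cylinder)
    show "AE k in ?G. norm ((v (N (r n)) k)\<^sup>2) \<le> 1" for n
      using v2[OF N(1)] by (intro always_eventually allI)
  qed simp_all
  moreover have "(\<lambda>n. s - 1 / Suc (r n)) \<longlonglongrightarrow> s - 0"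
    using LIMSEQ_subseq_LIMSEQ[OF LIMSEQ_inverse_real_of_nat r]
    by (intro tendsto_intros) (simp add: comp_def inverse_eq_divide)
  ultimately have "s \<le> \<Phi> \<mu>"
    using N(2) by (intro LIMSEQ_le[of "\<lambda>n. s - 1 / Suc (r n)" s]) (auto intro!: exI[of _ 0] less_imp_le)
  then have max: "\<Phi> \<nu> \<le> \<Phi> \<mu>" if "\<nu> \<in> ?K" for \<nu>
    using cSup_upper[OF imageI[OF that] bdd] by (simp add: s_def)
  show ?thesis
  proof (rule that[OF \<mu>K])
    fix \<nu>1 \<nu>2 a
    assume \<nu>: "\<nu>1 \<in> ?K" "\<nu>2 \<in> ?K" and a: "0 < a" "a < (1::real)"
      and eq: "\<And>C. C \<in> sets BX \<Longrightarrow> measure \<mu> C = a * measure \<nu>1 C + (1 - a) * measure \<nu>2 C"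
    have eq': "(v \<mu> n)\<^sup>2 = a * (v \<nu>1 n)\<^sup>2 + (1 - a) * (v \<nu>2 n)\<^sup>2 - a * (1 - a) * (v \<nu>1 n - v \<nu>2 n)\<^sup>2" for n
      unfolding v_def eq[OF sets_local[OF local_event_cylinder]] power2_eq_square by algebra
    have int': "integrable ?G (\<lambda>n. (v \<nu>1 n - v \<nu>2 n)\<^sup>2)"
    proof (rule measure_pmf.integrable_const_bound[of _ 1])
      have "\<bar>v \<nu>1 n - v \<nu>2 n\<bar> \<le> 1" for n
        using v[OF \<nu>(1), of n] v[OF \<nu>(2), of n] by (simp add: abs_le_iff)
      then show "AE n in ?G. norm ((v \<nu>1 n - v \<nu>2 n)\<^sup>2) \<le> 1"
        by (intro always_eventually allI) (simp add: abs_square_le_1)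
    qed simp
    have "\<Phi> \<mu> = a * \<Phi> \<nu>1 + (1 - a) * \<Phi> \<nu>2 - a * (1 - a) * (\<integral>n. (v \<nu>1 n - v \<nu>2 n)\<^sup>2 \<partial>?G)"
      unfolding \<Phi>_def eq' using int[OF \<nu>(1)] int[OF \<nu>(2)] int' by simp
    moreover have "a * \<Phi> \<nu>1 + (1 - a) * \<Phi> \<nu>2 \<le> \<Phi> \<mu>"
      using a by (intro convex_bound_le max \<nu>) auto
    ultimately have "a * (1 - a) * (\<integral>n. (v \<nu>1 n - v \<nu>2 n)\<^sup>2 \<partial>?G) \<le> 0" by linarith
    then have "(\<integral>n. (v \<nu>1 n - v \<nu>2 n)\<^sup>2 \<partial>?G) \<le> 0"
      using a by (simp add: mult_le_0_iff)
    then have "(\<integral>n. (v \<nu>1 n - v \<nu>2 n)\<^sup>2 \<partial>?G) = 0"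
      by (intro antisym integral_nonneg_AE) auto
    then have "AE n in ?G. (v \<nu>1 n - v \<nu>2 n)\<^sup>2 = 0"
      using integral_nonneg_eq_0_iff_AE[OF int'] by simp
    then have v_eq: "v \<nu>1 n = v \<nu>2 n" for n
      by (auto simp: AE_measure_pmf_iff set_pmf_geometric)
    show "\<nu>1 = \<nu>2"
    proof (rule borel_prob_on_eqI[OF K(1)[OF \<nu>(1)] K(1)[OF \<nu>(2)]])
      fix l :: "('a \<times> int) list"
      show "measure \<nu>1 (X \<inter> cylinder l) = measure \<nu>2 (X \<inter> cylinder l)"
        using v_eq[of "to_nat l"] by (simp add: v_def)
    qed
  qed
qed

end

section \<open>Harmonic functions and disjoint translates\<close>

text \<open>
  Maximum principle.  If \<open>u\<close> exceeded \<open>L\<close> somewhere, it would attain its maximum on a finite nonempty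
  set, which harmonicity makes invariant under right translation by the support of \<open>p\<close>, hence by
  the whole infinite group.
\<close>

lemma harmonic_le_limit:
  fixes u :: "'a::group_add \<Rightarrow> real" and p :: "'a pmf"
  assumes inf: "infinite (UNIV :: 'a set)" and gen: "generates (set_pmf p)"
    and bd: "\<And>g. \<bar>u g\<bar> \<le> B"
    and harm: "\<And>g. u g = (\<integral>s. u (g + s) \<partial>measure_pmf p)"
    and fin: "\<And>e. e > 0 \<Longrightarrow> finite {g. u g \<ge> L + e}"
  shows "u g \<le> L"
proof (rule ccontr)
  assume "\<not> u g \<le> L"
  then have finS0: "finite {h. u h \<ge> u g}"
    using fin[of "u g - L"] by simp
  define m where "m = Max (u ` {h. u h \<ge> u g})"
  have le_m: "u h \<le> m" for h
  proof (cases "u h \<ge> u g")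
    case True
    then show ?thesis unfolding m_def using finS0 by (intro Max_ge) auto
  next
    case False
    moreover have "u g \<le> m" unfolding m_def using finS0 by (intro Max_ge) auto
    ultimately show ?thesis by simp
  qed
  define S where "S = {h. u h = m}"
  have "m \<in> u ` {h. u h \<ge> u g}"
    unfolding m_def using finS0 by (intro Max_in) auto
  then obtain h0 where h0: "h0 \<in> S" "u h0 \<ge> u g" by (auto simp: S_def)
  have finS: "finite S"
    by (rule finite_subset[OF _ finS0]) (use h0 in \<open>auto simp: S_def\<close>)
  have int: "integrable (measure_pmf p) (\<lambda>s. u (h + s))" for h
    by (rule measure_pmf.integrable_const_bound[of _ B]) (use bd in auto)
  have step: "h + s \<in> S" if "h \<in> S" "s \<in> set_pmf p" for h s
  proof -
    have "(\<integral>s. m - u (h + s) \<partial>measure_pmf p) = 0"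
      using that(1) harm[of h] int[of h] by (simp add: S_def measure_pmf.prob_space)
    then have "AE s in measure_pmf p. m - u (h + s) = 0"
      using integral_nonneg_eq_0_iff_AE[of "measure_pmf p" "\<lambda>s. m - u (h + s)"] int[of h] le_m by simp
    with that(2) show ?thesis by (auto simp: S_def AE_measure_pmf_iff)
  qed
  define H where "H = {s. (\<lambda>h. h + s) ` S = S}"
  have "set_pmf p \<subseteq> H"
  proof
    fix s assume "s \<in> set_pmf p"
    then have "(\<lambda>h. h + s) ` S \<subseteq> S" using step by auto
    moreover have "inj_on (\<lambda>h. h + s) S" by (auto intro: inj_onI)
    ultimately show "s \<in> H"
      unfolding H_def using endo_inj_surj[OF finS] by blast
  qed
  moreover have "is_subgroup H"
    unfolding is_subgroup_def
  proof (intro conjI ballI)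
    show "0 \<in> H" by (simp add: H_def)
  next
    fix s t assume "s \<in> H" "t \<in> H"
    then have "(\<lambda>h. h + t) ` (\<lambda>h. h + s) ` S = S" by (simp add: H_def)
    then show "s + t \<in> H" by (simp add: H_def image_image add.assoc)
  next
    fix s assume "s \<in> H"
    then have "(\<lambda>h. h + - s) ` S = (\<lambda>h. h + - s) ` (\<lambda>h. h + s) ` S" by (simp add: H_def)
    then show "- s \<in> H" by (simp add: H_def image_image add.assoc)
  qed
  ultimately have "is_subgroup hull set_pmf p \<subseteq> H" by (rule hull_minimal)
  then have "H = UNIV" using gen by (auto simp: generates_def)
  then have "(\<lambda>h. h + (- h0 + k)) ` S = S" for k by (auto simp: H_def)
  then have "h0 + (- h0 + k) \<in> S" for k using h0(1) by blast
  then have "S = UNIV" by (auto simp: add.assoc[symmetric])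
  with finS inf show False by simp
qed

lemma disjoint_translates:
  fixes F G :: "'a::group_add set"
  assumes "finite F" "infinite G"
  shows "\<exists>D\<subseteq>G. finite D \<and> card D = n \<and>
    (\<forall>g\<in>D. \<forall>g'\<in>D. g \<noteq> g' \<longrightarrow> (\<lambda>h. h + g) ` F \<inter> (\<lambda>h. h + g') ` F = {})"
proof (induction n)
  case 0
  show ?case by (intro exI[of _ "{}"]) simp
next
  case (Suc n)
  then obtain D where D: "D \<subseteq> G" "finite D" "card D = n"
    "\<And>g g'. g \<in> D \<Longrightarrow> g' \<in> D \<Longrightarrow> g \<noteq> g' \<Longrightarrow> (\<lambda>h. h + g) ` F \<inter> (\<lambda>h. h + g') ` F = {}"
    by blast
  define bad where "bad = D \<union> (\<lambda>(f, f', g). - f + (f' + g)) ` (F \<times> F \<times> D)"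
  have "finite bad" using D(2) assms(1) by (simp add: bad_def)
  then obtain k where k: "k \<in> G" "k \<notin> bad"
    using assms(2) by (meson finite_subset subsetI)
  have *: "(\<lambda>h. h + k) ` F \<inter> (\<lambda>h. h + g) ` F = {}" if g: "g \<in> D" for g
  proof (rule ccontr)
    assume "(\<lambda>h. h + k) ` F \<inter> (\<lambda>h. h + g) ` F \<noteq> {}"
    then obtain f f' where f: "f \<in> F" "f' \<in> F" "f + k = f' + g" by auto
    then have "k = - f + (f' + g)" by (metis add.assoc add.left_neutral left_minus)
    with f g k(2) show False by (force simp: bad_def)
  qed
  show ?case
  proof (intro exI[of _ "insert k D"] conjI ballI impI)
    fix g g' assume "g \<in> insert k D" "g' \<in> insert k D" "g \<noteq> g'"
    then show "(\<lambda>h. h + g) ` F \<inter> (\<lambda>h. h + g') ` F = {}"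
      using * D(4) by (metis Int_commute insert_iff)
  qed (use D k in \<open>auto simp: bad_def\<close>)
qed

section \<open>Parity patterns\<close>

text \<open>
  The parity of an integer value.  The floor merely extends the notion to arbitrary reals.
\<close>

definition odd_at :: "('a \<Rightarrow> real) \<Rightarrow> 'a \<Rightarrow> bool" where
  "odd_at \<psi> h \<longleftrightarrow> odd \<lfloor>\<psi> h\<rfloor>"

text \<open>
  The parities on the window \<open>F\<close> follow the pattern \<open>y\<close> or its complement.  Working up to a global
  flip makes these events translation invariant in spite of the normalization \<open>- \<phi> g\<close> in the action.
\<close>

definition pattern_event :: "'a set \<Rightarrow> ('a \<Rightarrow> bool) \<Rightarrow> ('a \<Rightarrow> real) set" where
  "pattern_event F y = {\<psi>. \<exists>b. \<forall>h\<in>F. odd_at \<psi> h = (y h \<noteq> b)}"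

text \<open>
  The probability of \<open>pattern_event F y\<close> when the parities are independent and odd with probability
  \<open>t\<close>; this is meaningful for nonempty \<open>F\<close>, where the two values of the flip \<open>b\<close> exclude each other.
\<close>

definition pattern_prob :: "real \<Rightarrow> 'a set \<Rightarrow> ('a \<Rightarrow> bool) \<Rightarrow> real" where
  "pattern_prob t F y = (\<Sum>b\<in>UNIV. \<Prod>h\<in>F. if y h \<noteq> b then t else 1 - t)"

lemma local_event_pattern: "finite F \<Longrightarrow> local_event (pattern_event F y)"
  unfolding local_event_def determined_on_def pattern_event_def odd_at_def
  by (intro exI[of _ F]) auto

lemma pattern_prob_bounds:
  assumes "finite F" "F \<noteq> {}" "0 < t" "t < 1"
  shows "0 \<le> pattern_prob t F y" "pattern_prob t F y \<le> 1"
proof -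
  show "0 \<le> pattern_prob t F y"
    unfolding pattern_prob_def using assms by (intro sum_nonneg prod_nonneg) auto
  obtain h where h: "h \<in> F" using assms(2) by auto
  have "(\<Prod>h\<in>F. if y h \<noteq> b then t else 1 - t) \<le> (if y h \<noteq> b then t else 1 - t)" for b
  proof -
    have "(\<Prod>h\<in>F. if y h \<noteq> b then t else 1 - t)
        = (if y h \<noteq> b then t else 1 - t) * (\<Prod>h\<in>F - {h}. if y h \<noteq> b then t else 1 - t)"
      using assms(1) h by (rule prod.remove)
    also have "\<dots> \<le> (if y h \<noteq> b then t else 1 - t) * 1"
      using assms by (intro mult_left_mono prod_le_1) auto
    finally show ?thesis by simp
  qed
  then have "pattern_prob t F y \<le> (\<Sum>b\<in>UNIV. if y h \<noteq> b then t else 1 - t)"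
    unfolding pattern_prob_def by (intro sum_mono)
  then show "pattern_prob t F y \<le> 1" by (cases "y h") (simp_all add: UNIV_bool)
qed

lemma pattern_prob_translate:
  fixes F :: "'a::group_add set"
  shows "pattern_prob t ((\<lambda>h. h + g) ` F) (\<lambda>h. y (h - g)) = pattern_prob t F y"
proof -
  have "inj_on (\<lambda>h. h + g) F" by (auto intro: inj_onI)
  then show ?thesis by (simp add: pattern_prob_def prod.reindex comp_def)
qed

text \<open>The pattern that equals \<open>y\<close> on \<open>F\<close> and \<open>y'\<close> elsewhere.\<close>

definition glue :: "'a set \<Rightarrow> ('a \<Rightarrow> bool) \<Rightarrow> ('a \<Rightarrow> bool) \<Rightarrow> 'a \<Rightarrow> bool" where
  "glue F y y' h = (if h \<in> F then y h else y' h)"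

text \<open>
  The flips on the two windows may agree or disagree; these are the two events on the right.
\<close>

lemma pattern_event_Int:
  assumes "F \<inter> F' = {}"
  shows "pattern_event F y \<inter> pattern_event F' y' =
    pattern_event (F \<union> F') (glue F y y') \<union> pattern_event (F \<union> F') (glue F y (\<lambda>h. \<not> y' h))"
proof (intro equalityI subsetI)
  fix \<psi> assume "\<psi> \<in> pattern_event F y \<inter> pattern_event F' y'"
  then obtain b b' where b: "\<forall>h\<in>F. odd_at \<psi> h = (y h \<noteq> b)" "\<forall>h\<in>F'. odd_at \<psi> h = (y' h \<noteq> b')"
    by (auto simp: pattern_event_def)
  show "\<psi> \<in> pattern_event (F \<union> F') (glue F y y') \<union> pattern_event (F \<union> F') (glue F y (\<lambda>h. \<not> y' h))"
  proof (cases "b = b'")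
    case True
    with b have "\<forall>h\<in>F \<union> F'. odd_at \<psi> h = (glue F y y' h \<noteq> b)"
      using assms by (auto simp: glue_def)
    then show ?thesis by (auto simp: pattern_event_def)
  next
    case False
    with b have "\<forall>h\<in>F \<union> F'. odd_at \<psi> h = (glue F y (\<lambda>h. \<not> y' h) h \<noteq> b)"
      using assms by (auto simp: glue_def)
    then show ?thesis by (auto simp: pattern_event_def)
  qed
next
  fix \<psi> assume "\<psi> \<in> pattern_event (F \<union> F') (glue F y y') \<union> pattern_event (F \<union> F') (glue F y (\<lambda>h. \<not> y' h))"
  then show "\<psi> \<in> pattern_event F y \<inter> pattern_event F' y'"
  proof
    assume "\<psi> \<in> pattern_event (F \<union> F') (glue F y y')"
    then obtain b where b: "\<forall>h\<in>F \<union> F'. odd_at \<psi> h = (glue F y y' h \<noteq> b)"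
      by (auto simp: pattern_event_def)
    then have "\<forall>h\<in>F. odd_at \<psi> h = (y h \<noteq> b)" "\<forall>h\<in>F'. odd_at \<psi> h = (y' h \<noteq> b)"
      using assms by (auto simp: glue_def)
    then show ?thesis by (auto simp: pattern_event_def)
  next
    assume "\<psi> \<in> pattern_event (F \<union> F') (glue F y (\<lambda>h. \<not> y' h))"
    then obtain b where b: "\<forall>h\<in>F \<union> F'. odd_at \<psi> h = (glue F y (\<lambda>h. \<not> y' h) h \<noteq> b)"
      by (auto simp: pattern_event_def)
    then have "\<forall>h\<in>F. odd_at \<psi> h = (y h \<noteq> b)" "\<forall>h\<in>F'. odd_at \<psi> h = (y' h \<noteq> (\<not> b))"
      using assms by (auto simp: glue_def)
    then show ?thesis unfolding pattern_event_def by blast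
  qed
qed

lemma pattern_event_disjoint:
  assumes "F \<inter> F' = {}" "F \<noteq> {}" "F' \<noteq> {}"
  shows "pattern_event (F \<union> F') (glue F y y') \<inter> pattern_event (F \<union> F') (glue F y (\<lambda>h. \<not> y' h)) = {}"
proof (rule ccontr)
  assume "pattern_event (F \<union> F') (glue F y y') \<inter> pattern_event (F \<union> F') (glue F y (\<lambda>h. \<not> y' h)) \<noteq> {}"
  then obtain \<psi> b b' where b: "\<forall>h\<in>F \<union> F'. odd_at \<psi> h = (glue F y y' h \<noteq> b)"
    "\<forall>h\<in>F \<union> F'. odd_at \<psi> h = (glue F y (\<lambda>h. \<not> y' h) h \<noteq> b')"
    by (auto simp: pattern_event_def)
  obtain f f' where f: "f \<in> F" "f' \<in> F'" "f' \<notin> F" using assms by auto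
  have "b = b'" using bspec[OF b(1), of f] bspec[OF b(2), of f] f(1) by (auto simp: glue_def)
  moreover have "b \<noteq> b'" using bspec[OF b(1), of f'] bspec[OF b(2), of f'] f(2,3) by (auto simp: glue_def)
  ultimately show False by simp
qed

text \<open>
  Together with \<open>pattern_event_Int\<close> and \<open>pattern_event_disjoint\<close> this says that pattern events on
  disjoint windows are independent.
\<close>

lemma pattern_prob_Int:
  assumes "F \<inter> F' = {}" "finite F" "finite F'"
  shows "pattern_prob t (F \<union> F') (glue F y y') + pattern_prob t (F \<union> F') (glue F y (\<lambda>h. \<not> y' h))
    = pattern_prob t F y * pattern_prob t F' y'"
proof -
  define P where "P b = (\<Prod>h\<in>F. if y h \<noteq> b then t else 1 - t)" for b
  define P' where "P' b = (\<Prod>h\<in>F'. if y' h \<noteq> b then t else 1 - t)" for b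
  have "(\<Prod>h\<in>F. if glue F y z h \<noteq> b then t else 1 - t) = P b" for z b
    unfolding P_def by (intro prod.cong refl) (simp add: glue_def)
  moreover have "(\<Prod>h\<in>F'. if glue F y y' h \<noteq> b then t else 1 - t) = P' b" for b
    unfolding P'_def using assms(1) by (intro prod.cong refl) (auto simp: glue_def)
  moreover have "(\<Prod>h\<in>F'. if glue F y (\<lambda>h. \<not> y' h) h \<noteq> b then t else 1 - t) = P' (\<not> b)" for b
    unfolding P'_def using assms(1) by (intro prod.cong refl) (auto simp: glue_def)
  ultimately have "pattern_prob t (F \<union> F') (glue F y y') = (\<Sum>b\<in>UNIV. P b * P' b)"
    "pattern_prob t (F \<union> F') (glue F y (\<lambda>h. \<not> y' h)) = (\<Sum>b\<in>UNIV. P b * P' (\<not> b))"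
    using assms by (simp_all add: pattern_prob_def prod.union_disjoint)
  moreover have "pattern_prob t F y = P True + P False" "pattern_prob t F' y' = P' True + P' False"
    by (simp_all add: pattern_prob_def P_def P'_def UNIV_bool)
  ultimately show ?thesis by (simp add: UNIV_bool algebra_simps)
qed

context integral_system
begin

lemma odd_at_act: "\<psi> \<in> X \<Longrightarrow> odd_at (act g \<psi>) h = (odd_at \<psi> (h + g) \<noteq> odd_at \<psi> g)"
proof -
  assume "\<psi> \<in> X"
  from Ints[OF this, of "h + g"] Ints[OF this, of g]
  obtain i j where "\<psi> (h + g) = of_int i" "\<psi> g = of_int j" by (auto elim!: Ints_cases)
  then show ?thesis by (simp add: odd_at_def act_def flip: of_int_diff)
qed

lemma vimage_act_pattern:
  "X \<inter> act g -` pattern_event F y = X \<inter> pattern_event ((\<lambda>h. h + g) ` F) (\<lambda>h. y (h - g))"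
proof -
  have "act g \<psi> \<in> pattern_event F y \<longleftrightarrow> \<psi> \<in> pattern_event ((\<lambda>h. h + g) ` F) (\<lambda>h. y (h - g))"
    if "\<psi> \<in> X" for \<psi>
  proof -
    have "(\<exists>b. \<forall>h\<in>F. (odd_at \<psi> (h + g) \<noteq> odd_at \<psi> g) = (y h \<noteq> b)) \<longleftrightarrow>
        (\<exists>b. \<forall>h\<in>F. odd_at \<psi> (h + g) = (y h \<noteq> b))"
      by (cases "odd_at \<psi> g") (auto intro: exI[of _ "\<not> _"])
    then show ?thesis by (simp add: pattern_event_def odd_at_act[OF that])
  qed
  then show ?thesis by auto
qed

text \<open>
  The constraints that the parities have the Bernoulli pattern probabilities.  All local events that
  agree on \<open>X\<close> with a pattern event are included, because translates of pattern events are pattern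
  events only up to their parts outside of \<open>X\<close>.
\<close>

definition pattern_constraints :: "real \<Rightarrow> (('a \<Rightarrow> real) set \<times> real) set" where
  "pattern_constraints t = {(C, c). local_event C \<and>
     (\<exists>F y. finite F \<and> F \<noteq> {} \<and> X \<inter> C = X \<inter> pattern_event F y \<and> c = pattern_prob t F y)}"

lemma invariant_pattern_constraints: "invariant_constraints (pattern_constraints t)"
  unfolding invariant_constraints_def pattern_constraints_def
proof (clarsimp, intro conjI local_event_act)
  fix C F y g
  assume "finite F" "F \<noteq> {}" and *: "X \<inter> C = X \<inter> pattern_event F y"
  have "X \<inter> act g -` C = X \<inter> act g -` pattern_event F y"
    using * act_closed by blast
  then have "X \<inter> act g -` C = X \<inter> pattern_event ((\<lambda>h. h + g) ` F) (\<lambda>h. y (h - g))"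
    by (simp only: vimage_act_pattern)
  with \<open>finite F\<close> \<open>F \<noteq> {}\<close>
  show "\<exists>F'. finite F' \<and> F' \<noteq> {} \<and> (\<exists>y'. X \<inter> act g -` C = X \<inter> pattern_event F' y' \<and>
      pattern_prob t F y = pattern_prob t F' y')"
    by (intro exI[of _ "(\<lambda>h. h + g) ` F"] conjI exI[of _ "\<lambda>h. y (h - g)"])
      (simp_all add: pattern_prob_translate)
qed

lemma satisfies_pattern_iff:
  "satisfies \<nu> (pattern_constraints t) \<longleftrightarrow>
    (\<forall>F y. finite F \<longrightarrow> F \<noteq> {} \<longrightarrow> measure \<nu> (X \<inter> pattern_event F y) = pattern_prob t F y)"
proof (intro iffI allI impI)
  fix F :: "'a set" and y
  assume *: "satisfies \<nu> (pattern_constraints t)" "finite F" "F \<noteq> {}"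
  then have "(pattern_event F y, pattern_prob t F y) \<in> pattern_constraints t"
    unfolding pattern_constraints_def using local_event_pattern by blast
  with *(1) show "measure \<nu> (X \<inter> pattern_event F y) = pattern_prob t F y"
    by (auto simp only: satisfies_def)
next
  assume *: "\<forall>F y. finite F \<longrightarrow> F \<noteq> {} \<longrightarrow> measure \<nu> (X \<inter> pattern_event F y) = pattern_prob t F y"
  show "satisfies \<nu> (pattern_constraints t)"
    unfolding satisfies_def
  proof clarify
    fix C c assume "(C, c) \<in> pattern_constraints t"
    then obtain F y where "finite F" "F \<noteq> {}" "X \<inter> C = X \<inter> pattern_event F y" "c = pattern_prob t F y"
      unfolding pattern_constraints_def by blast
    with * show "measure \<nu> (X \<inter> C) = c" by metis
  qed
qed

end

section \<open>Ergodicity of extreme measures\<close>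

context integral_system
begin

lemma pattern_measure_Int:
  assumes \<nu>: "borel_prob_on X \<nu>" "satisfies \<nu> (pattern_constraints t)"
    and F: "finite F" "F \<noteq> {}" "finite F'" "F' \<noteq> {}" "F \<inter> F' = {}"
  shows "measure \<nu> (X \<inter> pattern_event F y \<inter> pattern_event F' y') = pattern_prob t F y * pattern_prob t F' y'"
proof -
  interpret prob_space \<nu> by (rule borel_prob_onD[OF \<nu>(1)])
  let ?A = "pattern_event (F \<union> F') (glue F y y')"
  let ?B = "pattern_event (F \<union> F') (glue F y (\<lambda>h. \<not> y' h))"
  have "X \<inter> pattern_event F y \<inter> pattern_event F' y' = (X \<inter> ?A) \<union> (X \<inter> ?B)"
    using pattern_event_Int[OF F(5), of y y'] by blast
  also have "measure \<nu> \<dots> = measure \<nu> (X \<inter> ?A) + measure \<nu> (X \<inter> ?B)"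
  proof (rule finite_measure_Union)
    show "X \<inter> ?A \<in> events" "X \<inter> ?B \<in> events"
      using F borel_prob_onD(2)[OF \<nu>(1)] by (simp_all add: sets_local local_event_pattern)
    show "(X \<inter> ?A) \<inter> (X \<inter> ?B) = {}"
      using pattern_event_disjoint[OF F(5,2,4), of y y'] by blast
  qed
  also have "\<dots> = pattern_prob t (F \<union> F') (glue F y y') + pattern_prob t (F \<union> F') (glue F y (\<lambda>h. \<not> y' h))"
    using \<nu>(2) F by (simp add: satisfies_pattern_iff)
  finally show ?thesis
    using pattern_prob_Int[OF F(5,1,3)] by simp
qed

text \<open>
  Invariant events and pattern events are uncorrelated; this is one half of it.  The function
  \<open>u g = \<nu> (A \<inter> act g -` C)\<close> is harmonic by stationarity of \<open>\<nu>\<close> and invariance of \<open>A\<close>, and its values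
  cannot exceed \<open>\<nu> A * q\<close> by \<open>e\<close> on an infinite set: among infinitely many translates one finds \<open>n\<close>
  with disjoint windows, and the sum \<open>Z\<close> of the centered indicators of these independent events has
  variance at most \<open>n\<close>, too small for a correlation \<open>n * e\<close> with \<open>A\<close> once \<open>n > 1 / e\<^sup>2\<close>.
\<close>

lemma invariant_measure_le:
  fixes p :: "'a pmf"
  assumes inf: "infinite (UNIV :: 'a set)" and gen: "generates (set_pmf p)"
    and t: "0 < t" "t < 1"
    and \<nu>: "\<nu> \<in> solutions p (pattern_constraints t)"
    and A: "A \<in> sets BX" "\<And>g. act g -` A \<inter> X = A"
    and F: "finite F" "F \<noteq> {}"
  shows "measure \<nu> (A \<inter> pattern_event F y) \<le> measure \<nu> A * pattern_prob t F y"
proof -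
  have \<nu>': "borel_prob_on X \<nu>" "stationary p \<nu>" "satisfies \<nu> (pattern_constraints t)"
    using \<nu> by (auto simp: solutions_def)
  interpret prob_space \<nu> by (rule borel_prob_onD[OF \<nu>'(1)])
  have sets: "events = sets BX" and space: "space \<nu> = X"
    using borel_prob_onD[OF \<nu>'(1)] by auto
  have AX: "A \<subseteq> X" using sets.sets_into_space[OF A(1)] by simp
  define q where "q = pattern_prob t F y"
  have q: "0 \<le> q" "q \<le> 1"
    unfolding q_def using pattern_prob_bounds[OF F t] by auto
  define C where "C g = X \<inter> act g -` pattern_event F y" for g
  have C_meas: "C g \<in> events" for g
    unfolding C_def sets by (intro sets_local local_event_act local_event_pattern F)
  define u where "u g = measure \<nu> (A \<inter> C g)" for g
  have C_eq: "C g = X \<inter> pattern_event ((\<lambda>h. h + g) ` F) (\<lambda>h. y (h - g))" for g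
    unfolding C_def by (rule vimage_act_pattern)
  have C_prob: "measure \<nu> (C g) = q" for g
    using \<nu>'(3) F by (simp add: C_eq satisfies_pattern_iff pattern_prob_translate q_def)
  have "u 0 \<le> measure \<nu> A * q"
  proof (rule harmonic_le_limit[OF inf gen])
    show "\<bar>u g\<bar> \<le> 1" for g by (simp add: u_def)
    show "u g = (\<integral>s. u (g + s) \<partial>measure_pmf p)" for g
    proof -
      have "act s -` (A \<inter> C g) \<inter> X = A \<inter> C (g + s)" for s
        using A(2)[of s] AX act_closed by (auto simp: C_def act_act)
      then show ?thesis
        unfolding u_def using stationaryD[OF \<nu>'(1,2), of "A \<inter> C g"] A(1) C_meas[of g]
        by (simp add: sets sets.Int)
    qed
    show "finite {g. u g \<ge> measure \<nu> A * q + e}" if e: "e > 0" for e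
    proof (rule ccontr)
      assume inf_G: "infinite {g. u g \<ge> measure \<nu> A * q + e}"
      obtain n :: nat where n: "1 / e\<^sup>2 < real n" using reals_Archimedean2 by blast
      obtain D where D: "D \<subseteq> {g. u g \<ge> measure \<nu> A * q + e}" "finite D" "card D = n"
        "\<And>g g'. g \<in> D \<Longrightarrow> g' \<in> D \<Longrightarrow> g \<noteq> g' \<Longrightarrow> (\<lambda>h. h + g) ` F \<inter> (\<lambda>h. h + g') ` F = {}"
        using disjoint_translates[OF F(1) inf_G, of n] by blast
      have ind [simp]: "integrable \<nu> (indicator B :: _ \<Rightarrow> real)" if "B \<in> events" for B
        using that by (simp add: emeasure_eq_measure)
      define Z where "Z \<psi> = (\<Sum>g\<in>D. indicator (C g) \<psi> - q)" for \<psi>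
      have int_AZ: "(\<integral>\<psi>. indicator A \<psi> * Z \<psi> \<partial>\<nu>) = (\<Sum>g\<in>D. u g - measure \<nu> A * q)"
        and integrable_AZ: "integrable \<nu> (\<lambda>\<psi>. indicator A \<psi> * Z \<psi>)"
      proof -
        have *: "indicator A \<psi> * Z \<psi> = (\<Sum>g\<in>D. indicator (A \<inter> C g) \<psi> - indicator A \<psi> * q)" for \<psi>
          by (simp add: Z_def sum_distrib_left indicator_inter_arith algebra_simps)
        have AC: "A \<inter> C g \<in> events" "A \<in> events" for g
          using A(1) C_meas by (auto simp: sets)
        show "integrable \<nu> (\<lambda>\<psi>. indicator A \<psi> * Z \<psi>)"
          unfolding * using AC by (intro Bochner_Integration.integrable_sum Bochner_Integration.integrable_diff) auto
        show "(\<integral>\<psi>. indicator A \<psi> * Z \<psi> \<partial>\<nu>) = (\<Sum>g\<in>D. u g - measure \<nu> A * q)"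
        proof -
          have "A \<inter> C g \<inter> X = A \<inter> C g" "A \<inter> X = A" for g using AX by auto
          then show ?thesis
            unfolding * using AC
            by (subst Bochner_Integration.integral_sum) (auto simp: u_def space)
        qed
      qed
      have int_Z2: "(\<integral>\<psi>. (Z \<psi>)\<^sup>2 \<partial>\<nu>) = (\<Sum>g\<in>D. \<Sum>g'\<in>D. measure \<nu> (C g \<inter> C g') - q\<^sup>2)"
        and integrable_Z2: "integrable \<nu> (\<lambda>\<psi>. (Z \<psi>)\<^sup>2)"
      proof -
        have *: "(Z \<psi>)\<^sup>2 = (\<Sum>g\<in>D. \<Sum>g'\<in>D.
            indicator (C g \<inter> C g') \<psi> - q * indicator (C g) \<psi> - q * indicator (C g') \<psi> + q\<^sup>2)" for \<psi>
          unfolding Z_def power2_eq_square sum_product indicator_inter_arith by (simp add: algebra_simps)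
        have CC: "C g \<inter> C g' \<in> events" for g g' using C_meas by auto
        have 1: "integrable \<nu> (\<lambda>\<psi>. indicator (C g \<inter> C g') \<psi> - q * indicator (C g) \<psi> - q * indicator (C g') \<psi> + q\<^sup>2)" for g g'
          using CC C_meas by simp
        show "integrable \<nu> (\<lambda>\<psi>. (Z \<psi>)\<^sup>2)"
          unfolding * by (intro Bochner_Integration.integrable_sum 1)
        have 2: "C g \<inter> X = C g" "C g \<inter> C g' \<inter> X = C g \<inter> C g'" for g g' by (auto simp: C_def)
        have "(\<integral>\<psi>. indicator (C g \<inter> C g') \<psi> - q * indicator (C g) \<psi> - q * indicator (C g') \<psi> + q\<^sup>2 \<partial>\<nu>)
            = measure \<nu> (C g \<inter> C g') - q\<^sup>2" for g g'
          using CC C_meas by (simp add: space 2 C_prob prob_space[unfolded space] power2_eq_square)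
        then show "(\<integral>\<psi>. (Z \<psi>)\<^sup>2 \<partial>\<nu>) = (\<Sum>g\<in>D. \<Sum>g'\<in>D. measure \<nu> (C g \<inter> C g') - q\<^sup>2)"
          unfolding * by (simp add: Bochner_Integration.integral_sum 1)
      qed
      have cov: "measure \<nu> (C g \<inter> C g') - q\<^sup>2 \<le> (if g = g' then 1 else 0)" if "g \<in> D" "g' \<in> D" for g g'
      proof (cases "g = g'")
        case True
        have "measure \<nu> (C g \<inter> C g') - q\<^sup>2 \<le> 1"
          using prob_le_1[of "C g \<inter> C g'"] zero_le_power2[of q] by linarith
        with True show ?thesis by simp
      next
        case False
        have "C g \<inter> C g' = X \<inter> pattern_event ((\<lambda>h. h + g) ` F) (\<lambda>h. y (h - g)) \<inter>
            pattern_event ((\<lambda>h. h + g') ` F) (\<lambda>h. y (h - g'))"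
          by (auto simp: C_eq)
        also have "measure \<nu> \<dots> = q * q"
          using pattern_measure_Int[OF \<nu>'(1,3), of "(\<lambda>h. h + g) ` F" "(\<lambda>h. h + g') ` F"] F D(4)[OF that False]
          by (simp add: pattern_prob_translate q_def)
        finally show ?thesis using False by (simp add: power2_eq_square)
      qed
      have "(\<integral>\<psi>. (Z \<psi>)\<^sup>2 \<partial>\<nu>) \<le> (\<Sum>g\<in>D. \<Sum>g'\<in>D. if g = g' then 1 else 0)"
        unfolding int_Z2 by (intro sum_mono cov)
      also have "\<dots> = real n" using D(2,3) by simp
      finally have Z2: "(\<integral>\<psi>. (Z \<psi>)\<^sup>2 \<partial>\<nu>) \<le> real n" .
      have n0: "real n > 0" using n by (smt (verit) divide_nonneg_nonneg zero_le_power2)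
      define c where "c = real n * e"
      have c: "c > 0" using n0 e by (simp add: c_def)
      have "c = (\<Sum>g\<in>D. e)" using D(3) by (simp add: c_def)
      also have "\<dots> \<le> (\<Sum>g\<in>D. u g - measure \<nu> A * q)"
        using D(1) by (intro sum_mono) auto
      also have "\<dots> = (\<integral>\<psi>. indicator A \<psi> * Z \<psi> \<partial>\<nu>)" by (simp add: int_AZ)
      also have "\<dots> \<le> (\<integral>\<psi>. (c + (Z \<psi>)\<^sup>2 / c) / 2 \<partial>\<nu>)"
      proof (rule integral_mono[OF integrable_AZ])
        show "integrable \<nu> (\<lambda>\<psi>. (c + (Z \<psi>)\<^sup>2 / c) / 2)" using integrable_Z2 by simp
        fix \<psi>
        \<comment> \<open>Young's inequality, balanced so that the term \<open>c\<close> is absorbed by the left-hand side.\<close>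
        have "0 \<le> (c - Z \<psi>)\<^sup>2" by simp
        then have "2 * Z \<psi> \<le> c + (Z \<psi>)\<^sup>2 / c"
          using c by (simp add: power2_eq_square field_simps)
        moreover have "0 \<le> c + (Z \<psi>)\<^sup>2 / c" using c by simp
        ultimately show "indicator A \<psi> * Z \<psi> \<le> (c + (Z \<psi>)\<^sup>2 / c) / 2"
          by (cases "\<psi> \<in> A") auto
      qed
      also have "\<dots> = (c + (\<integral>\<psi>. (Z \<psi>)\<^sup>2 \<partial>\<nu>) / c) / 2"
        using integrable_Z2 by (simp add: prob_space)
      also have "\<dots> \<le> (c + real n / c) / 2"
        using Z2 c by (simp add: divide_right_mono)
      finally have "c \<le> real n / c" by simp
      then have "c * c \<le> real n" using c by (simp only: pos_le_divide_eq)
      then have "real n * (real n * e\<^sup>2) \<le> real n * 1"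
        by (simp add: c_def power2_eq_square algebra_simps)
      then have "real n * e\<^sup>2 \<le> 1" using n0 by (rule mult_left_le_imp_le)
      with n e show False by (simp add: field_simps)
    qed
  qed
  moreover have "A \<inter> C 0 = A \<inter> pattern_event F y"
    using AX by (auto simp: C_eq)
  ultimately show ?thesis by (simp add: u_def q_def)
qed

lemma invariant_Compl:
  assumes "A \<in> sets BX" and inv: "\<And>g. act g -` A \<inter> X = A"
  shows "X - A \<in> sets BX" "act g -` (X - A) \<inter> X = X - A"
proof -
  show "X - A \<in> sets BX" using sets.compl_sets[OF assms(1)] by simp
  have "act g -` (X - A) \<inter> X = (act g -` X \<inter> X) - (act g -` A \<inter> X)" by auto
  also have "act g -` X \<inter> X = X" using act_closed by auto
  finally show "act g -` (X - A) \<inter> X = X - A" by (simp only: inv)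
qed

lemma invariant_measure_eq:
  fixes p :: "'a pmf"
  assumes inf: "infinite (UNIV :: 'a set)" and gen: "generates (set_pmf p)"
    and t: "0 < t" "t < 1"
    and \<nu>: "\<nu> \<in> solutions p (pattern_constraints t)"
    and A: "A \<in> sets BX" "\<And>g. act g -` A \<inter> X = A"
    and F: "finite F" "F \<noteq> {}"
  shows "measure \<nu> (A \<inter> pattern_event F y) = measure \<nu> A * pattern_prob t F y"
proof -
  have \<nu>': "borel_prob_on X \<nu>" "satisfies \<nu> (pattern_constraints t)"
    using \<nu> by (auto simp: solutions_def)
  interpret prob_space \<nu> by (rule borel_prob_onD[OF \<nu>'(1)])
  have sets: "events = sets BX" and space: "space \<nu> = X"
    using borel_prob_onD[OF \<nu>'(1)] by auto
  have AX: "A \<subseteq> X" using sets.sets_into_space[OF A(1)] by simp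
  have A': "X - A \<in> sets BX" "\<And>g. act g -` (X - A) \<inter> X = X - A"
    using invariant_Compl[OF A] by auto
  have P: "X \<inter> pattern_event F y \<in> events"
    using F by (simp add: sets sets_local local_event_pattern)
  have eqs: "A \<inter> (X \<inter> pattern_event F y) = A \<inter> pattern_event F y"
    "(X - A) \<inter> (X \<inter> pattern_event F y) = (X - A) \<inter> pattern_event F y"
    using AX by auto
  have "A \<inter> pattern_event F y \<in> events" "(X - A) \<inter> pattern_event F y \<in> events"
    using sets.Int[OF _ P, of A] sets.Int[OF _ P, of "X - A"] A A' unfolding eqs by (auto simp: sets)
  then have "measure \<nu> ((A \<inter> pattern_event F y) \<union> ((X - A) \<inter> pattern_event F y))
      = measure \<nu> (A \<inter> pattern_event F y) + measure \<nu> ((X - A) \<inter> pattern_event F y)"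
    by (intro finite_measure_Union) auto
  moreover have "(A \<inter> pattern_event F y) \<union> ((X - A) \<inter> pattern_event F y) = X \<inter> pattern_event F y"
    using AX by auto
  moreover have "measure \<nu> (X \<inter> pattern_event F y) = pattern_prob t F y"
    using \<nu>'(2) F by (simp add: satisfies_pattern_iff)
  moreover have "measure \<nu> (X - A) = 1 - measure \<nu> A"
    using prob_compl[of A] A(1) by (simp add: sets space)
  moreover have "measure \<nu> (A \<inter> pattern_event F y) \<le> measure \<nu> A * pattern_prob t F y"
    by (rule invariant_measure_le[OF inf gen t \<nu> A F])
  moreover have "measure \<nu> ((X - A) \<inter> pattern_event F y) \<le> measure \<nu> (X - A) * pattern_prob t F y"
    by (rule invariant_measure_le[OF inf gen t \<nu> A' F])
  moreover have "(1 - measure \<nu> A) * pattern_prob t F y = pattern_prob t F y - measure \<nu> A * pattern_prob t F y"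
    by (simp add: left_diff_distrib)
  ultimately show ?thesis by simp
qed

text \<open>Conditioning on an invariant event preserves stationarity and the pattern constraints.\<close>

lemma uniform_measure_solution:
  fixes p :: "'a pmf"
  assumes inf: "infinite (UNIV :: 'a set)" and gen: "generates (set_pmf p)"
    and t: "0 < t" "t < 1"
    and \<nu>: "\<nu> \<in> solutions p (pattern_constraints t)"
    and A: "A \<in> sets BX" "\<And>g. act g -` A \<inter> X = A" and pos: "measure \<nu> A > 0"
  shows "uniform_measure \<nu> A \<in> solutions p (pattern_constraints t)"
proof -
  have \<nu>': "borel_prob_on X \<nu>" "stationary p \<nu>" "satisfies \<nu> (pattern_constraints t)"
    using \<nu> by (auto simp: solutions_def)
  interpret prob_space \<nu> by (rule borel_prob_onD[OF \<nu>'(1)])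
  have sets: "events = sets BX" and space: "space \<nu> = X"
    using borel_prob_onD[OF \<nu>'(1)] by auto
  have AX: "A \<subseteq> X" using sets.sets_into_space[OF A(1)] by simp
  have meas: "measure (uniform_measure \<nu> A) B = measure \<nu> (A \<inter> B) / measure \<nu> A" if "B \<in> sets BX" for B
    by (rule measure_uniform_measure) (use pos A that in \<open>auto simp: emeasure_eq_measure sets\<close>)
  have ps: "borel_prob_on X (uniform_measure \<nu> A)"
    unfolding borel_prob_on_def
    by (intro conjI prob_space_uniform_measure) (use pos A in \<open>auto simp: emeasure_eq_measure sets\<close>)
  moreover have "stationary p (uniform_measure \<nu> A)"
  proof (rule stationaryI[OF ps])
    fix C :: "('a \<Rightarrow> real) set" assume C: "local_event C"
    have "act g -` (A \<inter> (X \<inter> C)) \<inter> X = A \<inter> (X \<inter> act g -` C)" for g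
      using A(2)[of g] AX act_closed by auto
    then have "measure \<nu> (A \<inter> (X \<inter> C)) = (\<integral>g. measure \<nu> (A \<inter> (X \<inter> act g -` C)) \<partial>measure_pmf p)"
      using stationaryD[OF \<nu>'(1,2), of "A \<inter> (X \<inter> C)"] A(1) sets_local[OF C] by (simp only: sets.Int)
    then show "measure (uniform_measure \<nu> A) (X \<inter> C) =
        (\<integral>g. measure (uniform_measure \<nu> A) (X \<inter> act g -` C) \<partial>measure_pmf p)"
      by (simp add: meas sets_local C local_event_act)
  qed
  moreover have "satisfies (uniform_measure \<nu> A) (pattern_constraints t)"
    unfolding satisfies_pattern_iff
  proof (intro allI impI)
    fix F :: "'a set" and y assume F: "finite F" "F \<noteq> {}"
    have "A \<inter> (X \<inter> pattern_event F y) = A \<inter> pattern_event F y" using AX by auto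
    then show "measure (uniform_measure \<nu> A) (X \<inter> pattern_event F y) = pattern_prob t F y"
      using pos invariant_measure_eq[OF inf gen t \<nu> A F, of y] F
      by (simp add: meas sets_local local_event_pattern)
  qed
  ultimately show ?thesis by (simp add: solutions_def)
qed

lemma ergodic_solution_exists:
  fixes p :: "'a pmf"
  assumes inf: "infinite (UNIV :: 'a set)" and gen: "generates (set_pmf p)"
    and t: "0 < t" "t < 1"
    and \<nu>0: "borel_prob_on X \<nu>0" "satisfies \<nu>0 (pattern_constraints t)"
  obtains \<nu> where "\<nu> \<in> ergodic_stationary_measures p X" "satisfies \<nu> (pattern_constraints t)"
proof -
  note V = invariant_pattern_constraints[of t]
  obtain \<nu> where \<nu>: "\<nu> \<in> solutions p (pattern_constraints t)"
    and ext: "\<And>\<nu>1 \<nu>2 a. \<nu>1 \<in> solutions p (pattern_constraints t) \<Longrightarrow>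
       \<nu>2 \<in> solutions p (pattern_constraints t) \<Longrightarrow> 0 < a \<Longrightarrow> a < 1 \<Longrightarrow>
       (\<And>C. C \<in> sets BX \<Longrightarrow> measure \<nu> C = a * measure \<nu>1 C + (1 - a) * measure \<nu>2 C) \<Longrightarrow> \<nu>1 = \<nu>2"
    using extreme_solution_exists[OF V stationary_solution_exists[OF \<nu>0 V, of p]] by metis
  have \<nu>': "borel_prob_on X \<nu>" "stationary p \<nu>" "satisfies \<nu> (pattern_constraints t)"
    using \<nu> by (auto simp: solutions_def)
  interpret prob_space \<nu> by (rule borel_prob_onD[OF \<nu>'(1)])
  have sets: "events = sets BX" and space: "space \<nu> = X"
    using borel_prob_onD[OF \<nu>'(1)] by auto
  have "ergodic \<nu>"
    unfolding ergodic_def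
  proof (intro ballI impI, rule ccontr)
    fix A assume A: "A \<in> events" "\<forall>g. act g -` A \<inter> space \<nu> = A"
      and "\<not> (measure \<nu> A = 0 \<or> measure \<nu> A = 1)"
    then have a: "0 < measure \<nu> A" "measure \<nu> A < 1"
      using prob_le_1[of A] by (auto simp: less_le)
    have A': "A \<in> sets BX" "\<And>g. act g -` A \<inter> X = A" using A by (auto simp: sets space)
    have AX: "A \<subseteq> X" using sets.sets_into_space[OF A'(1)] by simp
    have B: "X - A \<in> sets BX" "\<And>g. act g -` (X - A) \<inter> X = X - A"
      using invariant_Compl[OF A'] by auto
    have mB: "measure \<nu> (X - A) = 1 - measure \<nu> A"
      using prob_compl[OF A(1)] by (simp add: space)
    let ?\<nu>1 = "uniform_measure \<nu> A" and ?\<nu>2 = "uniform_measure \<nu> (X - A)"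
    have m1: "measure ?\<nu>1 C = measure \<nu> (A \<inter> C) / measure \<nu> A" if "C \<in> sets BX" for C
      by (rule measure_uniform_measure) (use a A' that in \<open>auto simp: emeasure_eq_measure sets\<close>)
    have m2: "measure ?\<nu>2 C = measure \<nu> ((X - A) \<inter> C) / (1 - measure \<nu> A)" if "C \<in> sets BX" for C
      unfolding mB[symmetric]
      by (rule measure_uniform_measure) (use a B mB that in \<open>auto simp: emeasure_eq_measure sets\<close>)
    have "?\<nu>1 = ?\<nu>2"
    proof (rule ext[of _ _ "measure \<nu> A"])
      show "?\<nu>1 \<in> solutions p (pattern_constraints t)" "?\<nu>2 \<in> solutions p (pattern_constraints t)"
        using uniform_measure_solution[OF inf gen t \<nu> A'] uniform_measure_solution[OF inf gen t \<nu> B] a mB by auto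
      fix C assume C: "C \<in> sets BX"
      then have "C \<subseteq> X" using sets.sets_into_space[OF C] by simp
      then have "C = (A \<inter> C) \<union> ((X - A) \<inter> C)" by auto
      also have "measure \<nu> \<dots> = measure \<nu> (A \<inter> C) + measure \<nu> ((X - A) \<inter> C)"
        using A' B C by (intro finite_measure_Union) (auto simp: sets)
      finally show "measure \<nu> C = measure \<nu> A * measure ?\<nu>1 C + (1 - measure \<nu> A) * measure ?\<nu>2 C"
        using a by (simp add: m1[OF C] m2[OF C])
    qed (use a in auto)
    then have "measure ?\<nu>1 A = measure ?\<nu>2 A" by simp
    moreover have "(X - A) \<inter> A = {}" by auto
    ultimately show False using a by (simp add: m1[OF A'(1)] m2[OF A'(1)])
  qed
  with \<nu>' that show ?thesis by (auto simp: ergodic_stationary_measures_def)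
qed

end

section \<open>Orbit closures of quasimorphisms with generic parity\<close>

lemma orbit_closure_eq_closure: "orbit_closure \<phi> = closure (range (\<lambda>g. act g \<phi>))"
proof -
  have "closed (Fo :: ('a \<Rightarrow> real) set)"
    unfolding Fo_def by (intro closed_Collect_eq continuous_intros continuous_on_product_coordinates)
  moreover have "range (\<lambda>g. act g \<phi>) \<subseteq> Fo" by (auto simp: Fo_def act_def)
  ultimately have "closure (range (\<lambda>g. act g \<phi>)) \<subseteq> Fo" by (intro closure_minimal)
  moreover have "Fo \<inter> range (\<lambda>g. act g \<phi>) = range (\<lambda>g. act g \<phi>)"
    using \<open>range (\<lambda>g. act g \<phi>) \<subseteq> Fo\<close> by (rule Int_absorb1)
  ultimately show ?thesis
    by (simp add: orbit_closure_def closure_of_subtopology Int_absorb1)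
qed

lemma integral_system_orbit_closure:
  fixes \<phi> :: "'a::{group_add, countable} \<Rightarrow> real"
  assumes "quasimorphism \<phi>" and Ints: "\<And>h. \<phi> h \<in> \<int>"
  shows "integral_system (orbit_closure \<phi>)"
  unfolding orbit_closure_eq_closure
proof
  let ?O = "range (\<lambda>g. act g \<phi>)"
  have coord: "continuous_on UNIV (\<lambda>\<psi>. \<psi> h)" for h :: 'a
    by (rule continuous_on_product_coordinates)
  obtain C where C: "\<And>g h. \<bar>\<phi> (g + h) - \<phi> g - \<phi> h\<bar> \<le> C"
    using assms(1) by (auto simp: quasimorphism_def bdd_above_def)
  define K where "K = (\<Pi>\<^sub>E h\<in>UNIV. cball (0::real) (\<bar>\<phi> h\<bar> + C))"
  have "compactin (product_topology (\<lambda>_::'a. euclidean :: real topology) UNIV) K"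
    unfolding K_def compactin_PiE by auto
  then have K: "compact K" by (simp add: euclidean_product_topology)
  have "\<bar>act g \<phi> h\<bar> \<le> \<bar>\<phi> h\<bar> + C" for g h
    using C[of h g] by (simp add: act_def)
  then have "?O \<subseteq> K" by (auto simp: K_def)
  then have "closure ?O \<subseteq> K" by (rule closure_minimal[OF _ compact_imp_closed[OF K]])
  then show "compact (closure ?O)"
    using compact_Int_closed[OF K, of "closure ?O"] by (simp add: Int_absorb1)
  fix \<psi> assume \<psi>: "\<psi> \<in> closure ?O"
  show "\<psi> h \<in> \<int>" for h
  proof -
    have "closed ((\<lambda>\<psi>. \<psi> h) -` (\<int> :: real set))"
      by (rule closed_vimage[OF closed_Ints coord])
    moreover have "?O \<subseteq> (\<lambda>\<psi>. \<psi> h) -` \<int>" using Ints by (auto simp: act_def)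
    ultimately have "closure ?O \<subseteq> (\<lambda>\<psi>. \<psi> h) -` \<int>" by (intro closure_minimal)
    with \<psi> show ?thesis by auto
  qed
  show "act g \<psi> \<in> closure ?O" for g
  proof -
    have "act g ` closure ?O \<subseteq> closure ?O"
    proof (rule image_closure_subset)
      show "act g ` ?O \<subseteq> closure ?O"
        using closure_subset[of ?O] by (auto simp: act_act)
    qed (auto intro: continuous_on_act)
    with \<psi> show ?thesis by auto
  qed
qed

lemma act_orbit_closure: "act g \<phi> \<in> orbit_closure \<phi>"
  unfolding orbit_closure_eq_closure by (intro subsetD[OF closure_subset]) auto

text \<open>
  The hypothesis \<open>gen\<close> says that every parity pattern on a finite window occurs in a translate of
  \<open>\<phi>\<close>.  Hence a Bernoulli pattern on the window \<open>W n\<close> can be lifted to a random point \<open>pick n\<close> of the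
  group, whose image in the orbit has the right pattern probabilities on \<open>W n\<close>.
\<close>

lemma pattern_measure_exists:
  fixes \<phi> :: "'a::{group_add, countable} \<Rightarrow> real"
  assumes X: "integral_system (orbit_closure \<phi>)" and zero: "\<phi> 0 = 0"
    and gen: "\<And>F y. finite F \<Longrightarrow> \<exists>g. \<forall>h\<in>F. odd_at \<phi> (h + g) = y h"
    and t: "0 < t" "t < 1"
  shows "\<exists>\<nu>. borel_prob_on (orbit_closure \<phi>) \<nu> \<and>
    integral_system.satisfies (orbit_closure \<phi>) \<nu> (integral_system.pattern_constraints (orbit_closure \<phi>) t)"
proof -
  interpret integral_system "orbit_closure \<phi>" by (rule X)
  let ?X = "orbit_closure \<phi>"
  have \<phi>X: "\<phi> \<in> ?X" using act_orbit_closure[of 0 \<phi>] zero by (simp add: act_def)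
  define W where "W n = (from_nat ` {..n} :: 'a set)" for n
  have W: "finite (W n)" for n by (simp add: W_def)
  have "\<exists>pick. \<forall>y. \<forall>h\<in>W n. odd_at \<phi> (h + pick y) = y h" for n
    using gen[OF W[of n]] by metis
  then obtain pick where pick: "\<And>n y h. h \<in> W n \<Longrightarrow> odd_at \<phi> (h + pick n y) = y h" by metis
  define m where "m n = Pi_pmf (W n) False (\<lambda>_. bernoulli_pmf t)" for n
  define \<nu> where "\<nu> n = distr (measure_pmf (m n)) BX (\<lambda>y. act (pick n y) \<phi>)" for n
  have meas: "(\<lambda>y. act (pick n y) \<phi>) \<in> measurable (measure_pmf (m n)) BX" for n
    by (intro measurableI) (auto simp: act_orbit_closure)
  have \<nu>: "borel_prob_on ?X (\<nu> n)" for n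
    using measure_pmf.prob_space_distr[OF meas[of n]] by (simp add: borel_prob_on_def \<nu>_def)
  have val: "measure (\<nu> n) (?X \<inter> pattern_event F y) = pattern_prob t F y"
    if F: "finite F" "F \<noteq> {}" "F \<subseteq> W n" for n F y
  proof -
    define Q where "Q b = {x. \<forall>h\<in>F. x h = (y h \<noteq> b)}" for b
    have Q_prob: "measure (m n) (Q b) = (\<Prod>h\<in>F. if y h \<noteq> b then t else 1 - t)" for b
    proof -
      have "Q b = Pi (W n) (\<lambda>h. if h \<in> F then {y h \<noteq> b} else UNIV)"
        using F(3) by (auto simp: Q_def Pi_def)
      then have "measure (m n) (Q b) =
          (\<Prod>h\<in>W n. measure (bernoulli_pmf t) (if h \<in> F then {y h \<noteq> b} else UNIV))"
        by (simp add: m_def measure_Pi_pmf_Pi W)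
      also have "\<dots> = (\<Prod>h\<in>F. measure (bernoulli_pmf t) (if h \<in> F then {y h \<noteq> b} else UNIV))"
        by (rule prod.mono_neutral_right[OF W F(3)]) simp
      also have "\<dots> = (\<Prod>h\<in>F. if y h \<noteq> b then t else 1 - t)"
        using t by (intro prod.cong refl) (simp add: measure_pmf_single)
      finally show ?thesis .
    qed
    have "act (pick n x) \<phi> \<in> pattern_event F y \<longleftrightarrow> x \<in> Q True \<union> Q False" for x
    proof -
      have "act (pick n x) \<phi> \<in> pattern_event F y \<longleftrightarrow> \<phi> \<in> ?X \<inter> act (pick n x) -` pattern_event F y"
        using \<phi>X by simp
      also have "\<dots> \<longleftrightarrow> (\<exists>b. \<forall>h\<in>F. odd_at \<phi> (h + pick n x) = (y h \<noteq> b))"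
        unfolding vimage_act_pattern using \<phi>X by (simp add: pattern_event_def)
      also have "\<dots> \<longleftrightarrow> (\<exists>b. x \<in> Q b)"
        using pick F(3) by (simp add: Q_def subset_eq)
      finally show ?thesis by (auto simp: ex_bool_eq)
    qed
    then have "(\<lambda>y. act (pick n y) \<phi>) -` (?X \<inter> pattern_event F y) \<inter> space (measure_pmf (m n)) = Q True \<union> Q False"
      by (auto simp: act_orbit_closure)
    then have "measure (\<nu> n) (?X \<inter> pattern_event F y) = measure (m n) (Q True \<union> Q False)"
      using measure_distr[OF meas, of "?X \<inter> pattern_event F y" n] F
      by (simp add: \<nu>_def sets_local local_event_pattern)
    also have "\<dots> = measure (m n) (Q True) + measure (m n) (Q False)"
      using F(2) by (intro measure_pmf.finite_measure_Union) (auto simp: Q_def)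
    finally show ?thesis by (simp add: Q_prob pattern_prob_def UNIV_bool)
  qed
  obtain r \<mu> where r: "strict_mono (r :: nat \<Rightarrow> nat)" and \<mu>: "borel_prob_on ?X \<mu>"
    and lim: "\<And>C. local_event C \<Longrightarrow> (\<lambda>n. measure (\<nu> (r n)) (?X \<inter> C)) \<longlonglongrightarrow> measure \<mu> (?X \<inter> C)"
    using sequentially_compact_local[of \<nu>, OF \<nu>] by blast
  have "satisfies \<mu> (pattern_constraints t)"
    unfolding satisfies_pattern_iff
  proof (intro allI impI)
    fix F :: "'a set" and y assume F: "finite F" "F \<noteq> {}"
    have "F \<subseteq> W n" if "n \<ge> Max (to_nat ` F)" for n
    proof
      fix h assume "h \<in> F"
      then have "to_nat h \<le> Max (to_nat ` F)" using F(1) by (intro Max_ge) auto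
      with that have "to_nat h \<le> n" by (rule order_trans[rotated])
      then show "h \<in> W n" by (auto simp: W_def intro!: image_eqI[of _ _ "to_nat h"])
    qed
    then have "F \<subseteq> W (r n)" if "n \<ge> Max (to_nat ` F)" for n
      using that seq_suble[OF r, of n] by auto
    then have "\<forall>\<^sub>F n in sequentially. measure (\<nu> (r n)) (?X \<inter> pattern_event F y) = pattern_prob t F y"
      unfolding eventually_sequentially using val[OF F] by (intro exI[of _ "Max (to_nat ` F)"]) blast
    then have "(\<lambda>n. measure (\<nu> (r n)) (?X \<inter> pattern_event F y)) \<longlonglongrightarrow> pattern_prob t F y"
      by (rule tendsto_eventually)
    then show "measure \<mu> (?X \<inter> pattern_event F y) = pattern_prob t F y"
      using LIMSEQ_unique lim[OF local_event_pattern[OF F(1)]] by blast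
  qed
  with \<mu> show ?thesis by blast
qed

lemma uncountable_ergodic_stationary_measures:
  fixes \<phi> :: "'a::{group_add, countable} \<Rightarrow> real" and p :: "'a pmf"
  assumes inf: "infinite (UNIV :: 'a set)" and supp: "generates (set_pmf p)"
    and \<phi>: "quasimorphism \<phi>" "\<And>h. \<phi> h \<in> \<int>"
    and gen: "\<And>F y. finite F \<Longrightarrow> \<exists>g. \<forall>h\<in>F. odd_at \<phi> (h + g) = y h"
  shows "uncountable (ergodic_stationary_measures p (orbit_closure \<phi>))"
proof -
  let ?X = "orbit_closure \<phi>"
  have sys: "integral_system ?X" by (rule integral_system_orbit_closure[OF \<phi>])
  interpret integral_system ?X by (rule sys)
  have zero: "\<phi> 0 = 0" using \<phi>(1) by (simp add: quasimorphism_def)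
  have "\<exists>\<nu>\<in>ergodic_stationary_measures p ?X. satisfies \<nu> (pattern_constraints t)"
    if t: "t \<in> {0<..<1/2}" for t
  proof -
    have t': "0 < t" "t < 1" using t by auto
    obtain \<nu>0 where "borel_prob_on ?X \<nu>0" "satisfies \<nu>0 (pattern_constraints t)"
      using pattern_measure_exists[OF sys zero gen t'] by blast
    from ergodic_solution_exists[OF inf supp t' this] show ?thesis by blast
  qed
  then obtain N where N: "\<And>t. t \<in> {0<..<1/2} \<Longrightarrow> N t \<in> ergodic_stationary_measures p ?X"
    "\<And>t. t \<in> {0<..<1/2} \<Longrightarrow> satisfies (N t) (pattern_constraints t)"
    by metis
  obtain k :: 'a where k: "k \<noteq> 0"
    using inf by (metis UNIV_eq_I finite.emptyI finite_insert insertCI)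
  \<comment> \<open>The probability of equal parities at \<open>0\<close> and \<open>k\<close> determines \<open>t\<close> below \<open>1/2\<close>.\<close>
  have prob: "pattern_prob t {0, k} (\<lambda>_. True) = t\<^sup>2 + (1 - t)\<^sup>2" for t
    using k by (simp add: pattern_prob_def UNIV_bool power2_eq_square)
  have "inj_on N {0<..<1/2}"
  proof (rule inj_onI)
    fix s t :: real assume st: "s \<in> {0<..<1/2}" "t \<in> {0<..<1/2}" "N s = N t"
    have "pattern_prob s {0, k} (\<lambda>_. True) = pattern_prob t {0, k} (\<lambda>_. True)"
      using N(2)[OF st(1)] N(2)[OF st(2)] st(3) unfolding satisfies_pattern_iff
      by (metis finite.emptyI finite_insert insert_not_empty)
    then have "(s - t) * (1 - s - t) = 0" unfolding prob by (simp add: power2_eq_square algebra_simps)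
    with st show "s = t" by auto
  qed
  moreover have "uncountable {0<..<1/2::real}" by (simp add: uncountable_open_interval)
  moreover have "N ` {0<..<1/2} \<subseteq> ergodic_stationary_measures p ?X" using N(1) by auto
  ultimately show ?thesis
    using countable_subset countable_image_inj_eq by metis
qed

section \<open>Generic perturbations\<close>

text \<open>
  A subset of \<open>P\<close> in whose translates every finite pattern occurs.  The countably many pairs of a
  window \<open>F n\<close> and a pattern \<open>S n\<close> are treated one after the other: a translate of \<open>F n\<close> inside \<open>P\<close>
  that avoids the set \<open>U n\<close> of places used before receives the pattern \<open>S n\<close>.
\<close>

lemma generic_subset_exists:
  fixes P :: "'a::{group_add, countable} set"
  assumes room: "\<And>F B. finite F \<Longrightarrow> finite B \<Longrightarrow> \<exists>g. (\<lambda>h. h + g) ` F \<subseteq> P - B"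
  obtains A where "A \<subseteq> P"
    "\<And>F y. finite F \<Longrightarrow> \<exists>g. \<forall>h\<in>F. h + g \<in> P \<and> (h + g \<in> A \<longleftrightarrow> y h)"
proof -
  obtain pick where pick: "\<And>F B. finite F \<Longrightarrow> finite B \<Longrightarrow> (\<lambda>h. h + pick F B) ` F \<subseteq> P - B"
    using room by metis
  define F where "F n = set (fst (from_nat n :: 'a list \<times> 'a list))" for n
  define S where "S n = set (snd (from_nat n :: 'a list \<times> 'a list))" for n
  define U where "U = rec_nat {} (\<lambda>n B. B \<union> (\<lambda>h. h + pick (F n) B) ` F n)"
  define g where "g n = pick (F n) (U n)" for n
  have U_simps: "U 0 = {}" "U (Suc n) = U n \<union> (\<lambda>h. h + g n) ` F n" for n
    by (simp_all add: U_def g_def)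
  have fin: "finite (F n)" "finite (U n)" for n
    by (simp add: F_def) (induction n, auto simp: U_simps F_def)
  have g: "(\<lambda>h. h + g n) ` F n \<subseteq> P - U n" for n
    unfolding g_def by (intro pick fin)
  have sub: "(\<lambda>h. h + g m) ` F m \<subseteq> U n" if "m < n" for m n
    using that by (induction n) (auto simp: U_simps less_Suc_eq)
  define A where "A = (\<Union>n. (\<lambda>h. h + g n) ` (F n \<inter> S n))"
  have A: "h + g n \<in> A \<longleftrightarrow> h \<in> S n" if h: "h \<in> F n" for h n
  proof
    assume "h + g n \<in> A"
    then obtain m h' where m: "h' \<in> F m" "h' \<in> S m" "h + g n = h' + g m" by (auto simp: A_def)
    have new: "h + g n \<notin> U n" "h' + g m \<notin> U m" using g h m(1) by blast+
    have "\<not> m < n" using sub[of m n] new(1) m by auto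
    moreover have "\<not> n < m" using sub[of n m] new(2) h m(3)[symmetric] by auto
    ultimately have "m = n" by simp
    with m show "h \<in> S n" by simp
  next
    assume "h \<in> S n"
    with h show "h + g n \<in> A" by (auto simp: A_def)
  qed
  show ?thesis
  proof (rule that[of A])
    show "A \<subseteq> P" using g by (fastforce simp: A_def)
    fix W :: "'a set" and y :: "'a \<Rightarrow> bool" assume W: "finite W"
    obtain xs where xs: "set xs = W" using finite_list[OF W] by blast
    define n where "n = to_nat (xs, filter y xs)"
    have n: "F n = W" "\<And>h. h \<in> W \<Longrightarrow> h \<in> S n \<longleftrightarrow> y h"
      by (auto simp: n_def F_def S_def xs)
    show "\<exists>g. \<forall>h\<in>W. h + g \<in> P \<and> (h + g \<in> A \<longleftrightarrow> y h)"
      using A[of _ n] g[of n] n by (intro exI[of _ "g n"]) auto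
  qed
qed

lemma quasimorphism_bounded_perturbation:
  assumes "quasimorphism \<phi>" "\<And>g. \<bar>\<phi> g - \<psi> g\<bar> \<le> K" "\<psi> 0 = 0"
  shows "quasimorphism \<psi>" "qm_equivalent \<phi> \<psi>"
proof -
  obtain C where C: "\<And>g h. \<bar>\<phi> (g + h) - \<phi> g - \<phi> h\<bar> \<le> C"
    using assms(1) by (auto simp: quasimorphism_def bdd_above_def)
  have "\<bar>\<psi> (g + h) - \<psi> g - \<psi> h\<bar> \<le> C + 3 * K" for g h
    using C[of g h] assms(2)[of "g + h"] assms(2)[of g] assms(2)[of h] by linarith
  then show "quasimorphism \<psi>"
    using assms(3) by (auto simp: quasimorphism_def bdd_above_def)
  show "qm_equivalent \<phi> \<psi>"
    unfolding qm_equivalent_def bounded_iff using assms(2) by auto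
qed

text \<open>
  The neutral element is avoided in order that the perturbed quasimorphism vanishes there.
\<close>

lemma infinite_group_room:
  fixes F B :: "'a::group_add set"
  assumes "infinite (UNIV :: 'a set)" "finite F" "finite B"
  shows "\<exists>g. (\<lambda>h. h + g) ` F \<subseteq> - {0} - B"
proof -
  have "finite ((\<lambda>(h, b). - h + b) ` (F \<times> insert 0 B))" using assms by auto
  then obtain g where g: "g \<notin> (\<lambda>(h, b). - h + b) ` (F \<times> insert 0 B)"
    using assms(1) ex_new_if_finite by metis
  have "h + g \<notin> insert 0 B" if "h \<in> F" for h
  proof
    assume "h + g \<in> insert 0 B"
    with that have "- h + (h + g) \<in> (\<lambda>(h, b). - h + b) ` (F \<times> insert 0 B)"
      by (intro image_eqI[of _ _ "(h, h + g)"]) auto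
    with g show False by (simp only: minus_add_cancel not_True_eq_False)
  qed
  then show ?thesis by (intro exI[of _ g]) auto
qed

lemma positive_half_room:
  fixes f :: "'a::group_add \<Rightarrow> int"
  assumes f: "surj f" "\<And>g h. f (g + h) = f g + f h" and "finite F" "finite B"
  shows "\<exists>g. (\<lambda>h. h + g) ` F \<subseteq> {h. f h > 0} - B"
proof -
  obtain g where g: "f g = (\<Sum>h\<in>F. \<bar>f h\<bar>) + (\<Sum>b\<in>B. \<bar>f b\<bar>) + 1"
    using f(1) by (metis surjE)
  have "f (h + g) > 0 \<and> h + g \<notin> B" if "h \<in> F" for h
  proof -
    have "\<bar>f h\<bar> \<le> (\<Sum>h\<in>F. \<bar>f h\<bar>)" using assms(3) that by (intro member_le_sum) auto
    then have gt: "f (h + g) > (\<Sum>b\<in>B. \<bar>f b\<bar>)" using g f(2)[of h g] by linarith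
    have le: "\<bar>f b\<bar> \<le> (\<Sum>b\<in>B. \<bar>f b\<bar>)" if "b \<in> B" for b
      using assms(4) that by (intro member_le_sum) auto
    have "0 \<le> (\<Sum>b\<in>B. \<bar>f b\<bar>)" by (intro sum_nonneg) auto
    with gt have "f (h + g) > 0" by linarith
    moreover have "h + g \<notin> B"
    proof
      assume "h + g \<in> B"
      from le[OF this] gt show False by linarith
    qed
    ultimately show ?thesis by simp
  qed
  then show ?thesis by (intro exI[of _ g]) auto
qed

text \<open>Rounding towards zero, which unlike the floor is an odd function.\<close>

definition round_to_zero :: "real \<Rightarrow> int" where
  "round_to_zero x = (if x \<ge> 0 then \<lfloor>x\<rfloor> else - \<lfloor>- x\<rfloor>)"

lemma round_to_zero: "\<bar>of_int (round_to_zero x) - x\<bar> \<le> 1" "round_to_zero (- x) = - round_to_zero x"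
proof -
  show "\<bar>of_int (round_to_zero x) - x\<bar> \<le> 1"
    unfolding round_to_zero_def by (cases "x \<ge> 0") (simp_all, linarith+)
  show "round_to_zero (- x) = - round_to_zero x"
    unfolding round_to_zero_def by (cases "x = 0") (simp_all add: not_le)
qed

lemma generic_equivalent:
  fixes \<phi>\<^sub>o :: "'a::{group_add, countable} \<Rightarrow> real"
  assumes inf: "infinite (UNIV :: 'a set)" and qm: "quasimorphism \<phi>\<^sub>o"
  obtains \<phi> :: "'a \<Rightarrow> int" where
    "quasimorphism (\<lambda>g. real_of_int (\<phi> g))" "qm_equivalent \<phi>\<^sub>o (\<lambda>g. real_of_int (\<phi> g))"
    "\<And>F y. finite F \<Longrightarrow> \<exists>g. \<forall>h\<in>F. odd_at (\<lambda>g. real_of_int (\<phi> g)) (h + g) = y h"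
proof -
  obtain A :: "'a set" where A: "A \<subseteq> - {0}"
    "\<And>F y. finite F \<Longrightarrow> \<exists>g. \<forall>h\<in>F. h + g \<in> - {0} \<and> (h + g \<in> A \<longleftrightarrow> y h)"
    using generic_subset_exists[OF infinite_group_room[OF inf]] by blast
  define \<phi> where "\<phi> g = 2 * \<lfloor>\<phi>\<^sub>o g / 2\<rfloor> + of_bool (g \<in> A)" for g
  have "\<bar>\<phi>\<^sub>o g - real_of_int (\<phi> g)\<bar> \<le> 3" for g
  proof -
    have "\<bar>\<phi>\<^sub>o g / 2 - of_int \<lfloor>\<phi>\<^sub>o g / 2\<rfloor>\<bar> \<le> 1" by linarith
    then show ?thesis by (auto simp: \<phi>_def of_bool_def)
  qed
  moreover have "\<phi> 0 = 0" using A(1) qm by (auto simp: \<phi>_def quasimorphism_def)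
  ultimately have qm': "quasimorphism (\<lambda>g. real_of_int (\<phi> g))" "qm_equivalent \<phi>\<^sub>o (\<lambda>g. real_of_int (\<phi> g))"
    using quasimorphism_bounded_perturbation[OF qm, of "\<lambda>g. real_of_int (\<phi> g)" 3] by auto
  have odd_at: "odd_at (\<lambda>g. real_of_int (\<phi> g)) h \<longleftrightarrow> h \<in> A" for h
    unfolding odd_at_def floor_of_int by (simp add: \<phi>_def)
  have "\<exists>g. \<forall>h\<in>F. odd_at (\<lambda>g. real_of_int (\<phi> g)) (h + g) = y h" if "finite F" for F y
    using A(2)[OF that, of y] unfolding odd_at by blast
  with qm' show ?thesis by (rule that)
qed

text \<open>
  As \<open>A\<close> lies in \<open>{f > 0}\<close> and \<open>- A\<close> in \<open>{f < 0}\<close>, subtracting the indicator of \<open>- A\<close> restores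
  antisymmetry without disturbing the parities on \<open>{f > 0}\<close>.
\<close>

lemma generic_antisymmetric_equivalent:
  fixes \<phi>\<^sub>o :: "'a::{group_add, countable} \<Rightarrow> real"
  assumes surj: "surjects_onto_int TYPE('a)" and qm: "quasimorphism \<phi>\<^sub>o"
  obtains \<phi> :: "'a \<Rightarrow> int" where
    "quasimorphism (\<lambda>g. real_of_int (\<phi> g))" "qm_equivalent \<phi>\<^sub>o (\<lambda>g. real_of_int (\<phi> g))"
    "\<And>F y. finite F \<Longrightarrow> \<exists>g. \<forall>h\<in>F. odd_at (\<lambda>g. real_of_int (\<phi> g)) (h + g) = y h"
    "antisymmetric (\<lambda>g. real_of_int (\<phi> g))"
proof -
  obtain f :: "'a \<Rightarrow> int" where f: "surj f" "\<And>g h. f (g + h) = f g + f h"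
    using surj by (auto simp: surjects_onto_int_def)
  have f0: "f 0 = 0" using f(2)[of 0 0] by simp
  have f_minus: "f (- g) = - f g" for g using f(2)[of g "- g"] f0 by simp
  obtain A :: "'a set" where A: "A \<subseteq> {h. f h > 0}"
    "\<And>F y. finite F \<Longrightarrow> \<exists>g. \<forall>h\<in>F. h + g \<in> {h. f h > 0} \<and> (h + g \<in> A \<longleftrightarrow> y h)"
    using generic_subset_exists[OF positive_half_room[OF f]] by blast
  obtain C where C: "\<And>g h. \<bar>\<phi>\<^sub>o (g + h) - \<phi>\<^sub>o g - \<phi>\<^sub>o h\<bar> \<le> C"
    using qm by (auto simp: quasimorphism_def bdd_above_def)
  \<comment> \<open>Half of the antisymmetrization of \<open>\<phi>\<^sub>o\<close>, which is at bounded distance from \<open>\<phi>\<^sub>o / 2\<close>.\<close>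
  define r where "r g = (\<phi>\<^sub>o g - \<phi>\<^sub>o (- g)) / 4" for g
  define \<phi> where "\<phi> g = 2 * round_to_zero (r g) + of_bool (g \<in> A) - of_bool (- g \<in> A)" for g
  have anti: "\<phi> (- g) = - \<phi> g" for g
  proof -
    have "r (- g) = - r g" by (simp add: r_def field_simps)
    then show ?thesis by (simp add: \<phi>_def round_to_zero(2))
  qed
  have "\<bar>\<phi>\<^sub>o g - real_of_int (\<phi> g)\<bar> \<le> C + 4" for g
  proof -
    have "\<bar>\<phi>\<^sub>o g + \<phi>\<^sub>o (- g)\<bar> \<le> C"
      using C[of g "- g"] qm by (simp add: quasimorphism_def)
    moreover have "\<bar>of_int (round_to_zero (r g)) - r g\<bar> \<le> 1" by (rule round_to_zero)
    moreover have "\<bar>real_of_int (\<phi> g) - 2 * real_of_int (round_to_zero (r g))\<bar> \<le> 1"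
      by (simp add: \<phi>_def of_bool_def)
    moreover have "4 * r g = \<phi>\<^sub>o g - \<phi>\<^sub>o (- g)" by (simp add: r_def)
    ultimately show ?thesis by linarith
  qed
  moreover have "\<phi> 0 = 0" using anti[of 0] by simp
  ultimately have qm': "quasimorphism (\<lambda>g. real_of_int (\<phi> g))" "qm_equivalent \<phi>\<^sub>o (\<lambda>g. real_of_int (\<phi> g))"
    using quasimorphism_bounded_perturbation[OF qm, of "\<lambda>g. real_of_int (\<phi> g)" "C + 4"] by auto
  have gen: "\<exists>g. \<forall>h\<in>F. odd_at (\<lambda>g. real_of_int (\<phi> g)) (h + g) = y h" if "finite F" for F y
  proof -
    have "odd_at (\<lambda>g. real_of_int (\<phi> g)) h \<longleftrightarrow> h \<in> A" if "f h > 0" for h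
    proof -
      have "- h \<notin> A" using A(1) that f_minus[of h] by auto
      then show ?thesis unfolding odd_at_def floor_of_int by (simp add: \<phi>_def)
    qed
    with A(2)[OF that, of y] show ?thesis by auto
  qed
  have "antisymmetric (\<lambda>g. real_of_int (\<phi> g))"
    by (simp add: antisymmetric_def anti)
  with qm' gen show ?thesis by (rule that)
qed

section \<open>Uncountably many ergodic stationary measures\<close>

theorem theorem1p13:
  fixes \<phi>\<^sub>o :: "'a::{group_add, countable} \<Rightarrow> real" and p :: "'a pmf"
  assumes "infinite (UNIV :: 'a set)"
    and "quasimorphism \<phi>\<^sub>o"
    and "symmetric_pmf p"
    and "generates (set_pmf p)"
    and "p_integrable p \<phi>\<^sub>o"
  shows "(\<exists>\<phi>\<^sub>1 :: 'a \<Rightarrow> int.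
            quasimorphism (\<lambda>g. real_of_int (\<phi>\<^sub>1 g)) \<and>
            qm_equivalent \<phi>\<^sub>o (\<lambda>g. real_of_int (\<phi>\<^sub>1 g)) \<and>
            uncountable (ergodic_stationary_measures p
              (orbit_closure (\<lambda>g. real_of_int (\<phi>\<^sub>1 g))))) \<and>
         (surjects_onto_int TYPE('a) \<longrightarrow>
          (\<exists>\<phi>\<^sub>1 :: 'a \<Rightarrow> int.
            quasimorphism (\<lambda>g. real_of_int (\<phi>\<^sub>1 g)) \<and>
            qm_equivalent \<phi>\<^sub>o (\<lambda>g. real_of_int (\<phi>\<^sub>1 g)) \<and>
            uncountable (ergodic_stationary_measures p
              (orbit_closure (\<lambda>g. real_of_int (\<phi>\<^sub>1 g)))) \<and>
            antisymmetric (\<lambda>g. real_of_int (\<phi>\<^sub>1 g))))"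
proof (intro conjI impI)
  note uncountable = uncountable_ergodic_stationary_measures[OF assms(1,4) _ Ints_of_int]
  show "\<exists>\<phi>\<^sub>1 :: 'a \<Rightarrow> int.
      quasimorphism (\<lambda>g. real_of_int (\<phi>\<^sub>1 g)) \<and>
      qm_equivalent \<phi>\<^sub>o (\<lambda>g. real_of_int (\<phi>\<^sub>1 g)) \<and>
      uncountable (ergodic_stationary_measures p
        (orbit_closure (\<lambda>g. real_of_int (\<phi>\<^sub>1 g))))"
  proof (rule generic_equivalent[OF assms(1,2)])
    fix \<phi> :: "'a \<Rightarrow> int"
    assume \<phi>: "quasimorphism (\<lambda>g. real_of_int (\<phi> g))" "qm_equivalent \<phi>\<^sub>o (\<lambda>g. real_of_int (\<phi> g))"
      "\<And>F y. finite F \<Longrightarrow> \<exists>g. \<forall>h\<in>F. odd_at (\<lambda>g. real_of_int (\<phi> g)) (h + g) = y h"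
    show ?thesis
      by (intro exI[of _ \<phi>] conjI \<phi>(1,2) uncountable[OF \<phi>(1,3)])
  qed
  assume "surjects_onto_int TYPE('a)"
  then show "\<exists>\<phi>\<^sub>1 :: 'a \<Rightarrow> int.
      quasimorphism (\<lambda>g. real_of_int (\<phi>\<^sub>1 g)) \<and>
      qm_equivalent \<phi>\<^sub>o (\<lambda>g. real_of_int (\<phi>\<^sub>1 g)) \<and>
      uncountable (ergodic_stationary_measures p
        (orbit_closure (\<lambda>g. real_of_int (\<phi>\<^sub>1 g)))) \<and>
      antisymmetric (\<lambda>g. real_of_int (\<phi>\<^sub>1 g))"
  proof (rule generic_antisymmetric_equivalent[OF _ assms(2)])
    fix \<phi> :: "'a \<Rightarrow> int"
    assume \<phi>: "quasimorphism (\<lambda>g. real_of_int (\<phi> g))" "qm_equivalent \<phi>\<^sub>o (\<lambda>g. real_of_int (\<phi> g))"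
      "\<And>F y. finite F \<Longrightarrow> \<exists>g. \<forall>h\<in>F. odd_at (\<lambda>g. real_of_int (\<phi> g)) (h + g) = y h"
      "antisymmetric (\<lambda>g. real_of_int (\<phi> g))"
    show ?thesis
      by (intro exI[of _ \<phi>] conjI \<phi>(1,2,4) uncountable[OF \<phi>(1,3)])
  qed
qed

end
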